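(* Every projective Banach lattice has the $1_+$-strong Nakano property.
   Context: A Banach lattice $Z$ is projective if for every Banach lattice $X$, every closed ideal $J\subset X$, every lattice homomorphism $T:Z\to X/J$ and every $\varepsilon>0$, there exists a lattice homomorphism $\hat T:Z\to X$ such that $T=Q\circ\hat T$ (where $Q:X\to X/J$ is the quotient map) and $\|\hat T\|\le(1+\varepsilon)\|T\|$. A Banach lattice $X$ has the $1_+$-strong Nakano property if for every norm-bounded (non-empty) upwards directed set $A\subset X_+$ and every $\lambda'>1$ there is an upper bound $b\in X_+$ of $A$ with $\|b\|\le\lambda'\sup\{\|a\|:a\in A\}$. *)

theory Defs
  imports "HOL-Analysis.Analysis"
begin

text \<open>Banach lattices are carrier-based structures rather than a type class: projectivity
  quantifies over all Banach lattices \<open>X\<close> and uses the quotients \<open>X / J\<close>. Operations are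
  unconstrained outside the carrier.\<close>

record 'a normed_lattice =
  carrierv :: "'a set"
  addv :: "'a \<Rightarrow> 'a \<Rightarrow> 'a"
  zerov :: 'a
  scalev :: "real \<Rightarrow> 'a \<Rightarrow> 'a"
  lev :: "'a \<Rightarrow> 'a \<Rightarrow> bool"
  normv :: "'a \<Rightarrow> real"

definition minusv :: "('a, 'm) normed_lattice_scheme \<Rightarrow> 'a \<Rightarrow> 'a \<Rightarrow> 'a" where
  "minusv X x y = addv X x (scalev X (- 1) y)"

definition is_supv :: "('a, 'm) normed_lattice_scheme \<Rightarrow> 'a \<Rightarrow> 'a \<Rightarrow> 'a \<Rightarrow> bool" where
  "is_supv X x y s \<longleftrightarrow> s \<in> carrierv X \<and> lev X x s \<and> lev X y s \<and>
     (\<forall>u\<in>carrierv X. lev X x u \<and> lev X y u \<longrightarrow> lev X s u)"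

definition is_infv :: "('a, 'm) normed_lattice_scheme \<Rightarrow> 'a \<Rightarrow> 'a \<Rightarrow> 'a \<Rightarrow> bool" where
  "is_infv X x y s \<longleftrightarrow> s \<in> carrierv X \<and> lev X s x \<and> lev X s y \<and>
     (\<forall>u\<in>carrierv X. lev X u x \<and> lev X u y \<longrightarrow> lev X u s)"

definition supv :: "('a, 'm) normed_lattice_scheme \<Rightarrow> 'a \<Rightarrow> 'a \<Rightarrow> 'a" where
  "supv X x y = (THE s. is_supv X x y s)"

definition infv :: "('a, 'm) normed_lattice_scheme \<Rightarrow> 'a \<Rightarrow> 'a \<Rightarrow> 'a" where
  "infv X x y = (THE s. is_infv X x y s)"

definition absv :: "('a, 'm) normed_lattice_scheme \<Rightarrow> 'a \<Rightarrow> 'a" where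
  "absv X x = supv X x (scalev X (- 1) x)"

definition posv :: "('a, 'm) normed_lattice_scheme \<Rightarrow> 'a set" where
  "posv X = {x \<in> carrierv X. lev X (zerov X) x}"

definition tendsto_normv ::
    "('a, 'm) normed_lattice_scheme \<Rightarrow> (nat \<Rightarrow> 'a) \<Rightarrow> 'a \<Rightarrow> bool" where
  "tendsto_normv X f l \<longleftrightarrow> (\<lambda>n. normv X (minusv X (f n) l)) \<longlonglongrightarrow> 0"

definition cauchy_normv :: "('a, 'm) normed_lattice_scheme \<Rightarrow> (nat \<Rightarrow> 'a) \<Rightarrow> bool" where
  "cauchy_normv X f \<longleftrightarrow>
     (\<forall>e>0. \<exists>N. \<forall>m\<ge>N. \<forall>n\<ge>N. normv X (minusv X (f m) (f n)) < e)"

locale vector_lattice =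
  fixes X :: "('a, 'm) normed_lattice_scheme"
  assumes zero_closed: "zerov X \<in> carrierv X"
    and add_closed: "\<lbrakk>x \<in> carrierv X; y \<in> carrierv X\<rbrakk> \<Longrightarrow> addv X x y \<in> carrierv X"
    and scale_closed: "x \<in> carrierv X \<Longrightarrow> scalev X r x \<in> carrierv X"
    and add_assoc: "\<lbrakk>x \<in> carrierv X; y \<in> carrierv X; z \<in> carrierv X\<rbrakk> \<Longrightarrow>
          addv X (addv X x y) z = addv X x (addv X y z)"
    and add_commute: "\<lbrakk>x \<in> carrierv X; y \<in> carrierv X\<rbrakk> \<Longrightarrow> addv X x y = addv X y x"
    and add_zero: "x \<in> carrierv X \<Longrightarrow> addv X x (zerov X) = x"
    and add_inverse: "x \<in> carrierv X \<Longrightarrow> \<exists>y\<in>carrierv X. addv X x y = zerov X"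
    and scale_add_right: "\<lbrakk>x \<in> carrierv X; y \<in> carrierv X\<rbrakk> \<Longrightarrow>
          scalev X r (addv X x y) = addv X (scalev X r x) (scalev X r y)"
    and scale_add_left: "x \<in> carrierv X \<Longrightarrow>
          scalev X (r + s) x = addv X (scalev X r x) (scalev X s x)"
    and scale_scale: "x \<in> carrierv X \<Longrightarrow> scalev X r (scalev X s x) = scalev X (r * s) x"
    and scale_one: "x \<in> carrierv X \<Longrightarrow> scalev X 1 x = x"
    and le_refl: "x \<in> carrierv X \<Longrightarrow> lev X x x"
    and le_antisym: "\<lbrakk>x \<in> carrierv X; y \<in> carrierv X; lev X x y; lev X y x\<rbrakk> \<Longrightarrow> x = y"
    and le_trans: "\<lbrakk>x \<in> carrierv X; y \<in> carrierv X; z \<in> carrierv X;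
          lev X x y; lev X y z\<rbrakk> \<Longrightarrow> lev X x z"
    and le_add: "\<lbrakk>x \<in> carrierv X; y \<in> carrierv X; z \<in> carrierv X; lev X x y\<rbrakk> \<Longrightarrow>
          lev X (addv X x z) (addv X y z)"
    and le_scale: "\<lbrakk>x \<in> carrierv X; y \<in> carrierv X; lev X x y; 0 \<le> r\<rbrakk> \<Longrightarrow>
          lev X (scalev X r x) (scalev X r y)"
    and sup_exists: "\<lbrakk>x \<in> carrierv X; y \<in> carrierv X\<rbrakk> \<Longrightarrow> \<exists>s. is_supv X x y s"
    and inf_exists: "\<lbrakk>x \<in> carrierv X; y \<in> carrierv X\<rbrakk> \<Longrightarrow> \<exists>s. is_infv X x y s"

locale banach_lattice = vector_lattice X
  for X :: "('a, 'm) normed_lattice_scheme" +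
  assumes norm_eq_zero: "x \<in> carrierv X \<Longrightarrow> normv X x = 0 \<longleftrightarrow> x = zerov X"
    and norm_scale: "x \<in> carrierv X \<Longrightarrow> normv X (scalev X r x) = \<bar>r\<bar> * normv X x"
    and norm_triangle: "\<lbrakk>x \<in> carrierv X; y \<in> carrierv X\<rbrakk> \<Longrightarrow>
          normv X (addv X x y) \<le> normv X x + normv X y"
    and norm_mono: "\<lbrakk>x \<in> carrierv X; y \<in> carrierv X; lev X (absv X x) (absv X y)\<rbrakk> \<Longrightarrow>
          normv X x \<le> normv X y"
    and complete: "\<lbrakk>range f \<subseteq> carrierv X; cauchy_normv X f\<rbrakk> \<Longrightarrow>
          \<exists>l\<in>carrierv X. tendsto_normv X f l"

definition closed_ideal :: "('a, 'm) normed_lattice_scheme \<Rightarrow> 'a set \<Rightarrow> bool" where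
  "closed_ideal X J \<longleftrightarrow>
     J \<subseteq> carrierv X \<and> zerov X \<in> J \<and>
     (\<forall>x\<in>J. \<forall>y\<in>J. addv X x y \<in> J) \<and>
     (\<forall>r. \<forall>x\<in>J. scalev X r x \<in> J) \<and>
     (\<forall>x\<in>carrierv X. \<forall>y\<in>J. lev X (absv X x) (absv X y) \<longrightarrow> x \<in> J) \<and>
     (\<forall>f l. range f \<subseteq> J \<and> l \<in> carrierv X \<and> tendsto_normv X f l \<longrightarrow> l \<in> J)"

definition quotient_map :: "('a, 'm) normed_lattice_scheme \<Rightarrow> 'a set \<Rightarrow> 'a \<Rightarrow> 'a set" where
  "quotient_map X J x = addv X x ` J"

text \<open>The summand from \<open>J\<close> in the scalar multiplication is needed for \<open>r = 0\<close> only. The order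
  is the one whose positive cone is the image of the positive cone of \<open>X\<close>.\<close>

definition quotient_lattice ::
    "('a, 'm) normed_lattice_scheme \<Rightarrow> 'a set \<Rightarrow> 'a set normed_lattice" where
  "quotient_lattice X J =
     \<lparr>carrierv = quotient_map X J ` carrierv X,
      addv = (\<lambda>A B. {addv X a b |a b. a \<in> A \<and> b \<in> B}),
      zerov = J,
      scalev = (\<lambda>r A. {addv X (scalev X r a) j |a j. a \<in> A \<and> j \<in> J}),
      lev = (\<lambda>A B. \<exists>a\<in>A. \<exists>b\<in>B. lev X a b),
      normv = (\<lambda>A. Inf (normv X ` A))\<rparr>"

text \<open>Boundedness is automatic for lattice homomorphisms between Banach lattices; it is listed
  so that the operator norm below is visibly a supremum of a bounded set.\<close>

definition lattice_hom ::
    "('a, 'm) normed_lattice_scheme \<Rightarrow> ('b, 'n) normed_lattice_scheme \<Rightarrow> ('a \<Rightarrow> 'b) \<Rightarrow> bool" where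
  "lattice_hom X Y T \<longleftrightarrow>
     (\<forall>x\<in>carrierv X. T x \<in> carrierv Y) \<and>
     (\<forall>x\<in>carrierv X. \<forall>y\<in>carrierv X. T (addv X x y) = addv Y (T x) (T y)) \<and>
     (\<forall>r. \<forall>x\<in>carrierv X. T (scalev X r x) = scalev Y r (T x)) \<and>
     (\<forall>x\<in>carrierv X. \<forall>y\<in>carrierv X. T (supv X x y) = supv Y (T x) (T y)) \<and>
     (\<forall>x\<in>carrierv X. \<forall>y\<in>carrierv X. T (infv X x y) = infv Y (T x) (T y)) \<and>
     (\<exists>K. \<forall>x\<in>carrierv X. normv Y (T x) \<le> K * normv X x)"

definition op_norm ::
    "('a, 'm) normed_lattice_scheme \<Rightarrow> ('b, 'n) normed_lattice_scheme \<Rightarrow> ('a \<Rightarrow> 'b) \<Rightarrow> real" where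
  "op_norm X Y T = Sup {normv Y (T x) |x. x \<in> carrierv X \<and> normv X x \<le> 1}"

text \<open>A definition in HOL cannot quantify over all types, so the test lattices \<open>X\<close> range over all
  Banach lattices whose carrier is a set of elements of type \<open>('a \<Rightarrow> real) \<Rightarrow> real\<close>, i.e. up to
  isomorphism over all Banach lattices of at most that cardinality. Every Banach lattice that is
  projective in the unrestricted sense is projective in this sense. Conversely nothing is lost.
  The case \<open>Z = 0\<close> is trivial. Otherwise, given \<open>T : Z \<rightarrow> X / J\<close> with \<open>X\<close> arbitrary, choose for each
  \<open>z\<close> in \<open>Z\<close> and \<open>n \<ge> 1\<close> a preimage of \<open>T z\<close> in \<open>X\<close> of norm at most \<open>norm (T z) + 1 / n\<close>, and let \<open>X'\<close>
  be the closed sublattice of \<open>X\<close> these generate. Then \<open>X'\<close> has at most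
  \<open>card Z ^ aleph_0 = card Z\<close> elements, \<open>T\<close> factors through \<open>X' / (X' \<inter> J)\<close> with the same norm,
  and a lifting into \<open>X'\<close> is a lifting into \<open>X\<close>.\<close>

definition projective_lattice :: "('a, 'm) normed_lattice_scheme \<Rightarrow> bool" where
  "projective_lattice Z \<longleftrightarrow>
     (\<forall>(X :: (('a \<Rightarrow> real) \<Rightarrow> real) normed_lattice) J T \<epsilon>.
        banach_lattice X \<and> closed_ideal X J \<and> lattice_hom Z (quotient_lattice X J) T \<and> 0 < \<epsilon> \<longrightarrow>
        (\<exists>T'. lattice_hom Z X T' \<and>
           (\<forall>z\<in>carrierv Z. T z = quotient_map X J (T' z)) \<and>
           op_norm Z X T' \<le> (1 + \<epsilon>) * op_norm Z (quotient_lattice X J) T))"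

definition strong_nakano_1_plus :: "('a, 'm) normed_lattice_scheme \<Rightarrow> bool" where
  "strong_nakano_1_plus X \<longleftrightarrow>
     (\<forall>A l. A \<subseteq> posv X \<and> A \<noteq> {} \<and> bdd_above (normv X ` A) \<and>
        (\<forall>a\<in>A. \<forall>b\<in>A. \<exists>c\<in>A. lev X a c \<and> lev X b c) \<and> 1 < l \<longrightarrow>
        (\<exists>b\<in>posv X. (\<forall>a\<in>A. lev X a b) \<and> normv X b \<le> l * Sup (normv X ` A)))"

end

theory Submission
  imports Defs "HOL-Algebra.FiniteProduct"
begin

text \<open>
  Let \<open>U\<close> be the closed unit ball of the given Banach lattice (called \<open>X\<close> in the lemmas and \<open>Z\<close> in
  the theorem). It is a quotient of the free Banach lattice over the set \<open>U\<close>, in which upper bounds of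
  directed sets come from a compactness argument; projectivity carries them over to the quotient.

  The free Banach lattice, \<open>cover\<close>, consists of functions \<open>f\<close> of finitely supported vectors \<open>x\<close>. It
  is generated by the coordinates \<open>x \<mapsto> x a\<close> with \<open>a \<in> U\<close>, and the norm of \<open>f\<close> is the least total
  weight of a nonnegative \<open>c\<close> on \<open>U\<close> with \<open>\<bar>f x\<bar> \<le> (\<Sum>a. c a * \<bar>x a\<bar>)\<close> for all \<open>x\<close>. The weights of total
  at most \<open>r\<close> form a compact set in the product topology, and because \<open>x\<close> has finite support the
  majorant depends continuously on \<open>c\<close> at each \<open>x\<close>. Hence an upwards directed set of functions each of
  which has a majorant of total weight at most \<open>r\<close> has a common one
  (\<open>weighted_norm_compactness\<close>, \<open>directed_bound_in_cover\<close>), and this majorant belongs to \<open>cover\<close>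
  (\<open>represents_weighted_norm\<close>). The same compactness gives completeness of \<open>cover\<close>.

  Sending the coordinate of \<open>a\<close> to \<open>a\<close> extends to a lattice homomorphism from \<open>cover\<close> onto the given
  lattice, the relation \<open>represents\<close>. That it is well defined and contractive comes from one
  elementary fact: a linear form below the maximum of finitely many linear forms is a convex
  combination of them (\<open>convex_combination_if_le_Max\<close>), so it lies below their supremum in every vector
  lattice. Each generated function is a difference of two such maxima; so a pointwise
  inequality between generated functions implies the same inequality between the elements that they
  represent (\<open>max_form_mono\<close>), and a majorant of total weight \<open>r\<close> gives norm at most \<open>r\<close>
  (\<open>lattice_form_contractive\<close>). The functions representing \<open>z\<close> form a coset of the kernel, and
  \<open>fibre\<close>, which sends \<open>z\<close> to this coset, is an isometric lattice isomorphism onto the quotient.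

  Projectivity lifts \<open>fibre\<close> to a homomorphism into \<open>cover\<close> of norm at most \<open>1 + \<epsilon>\<close>. It maps a bounded
  directed set to a bounded directed set of functions, and the element represented by a common
  majorant of these is the desired upper bound (\<open>strong_nakano_if_lift\<close>).
\<close>

section \<open>Order and norm in vector lattices\<close>

context vector_lattice
begin

abbreviation plus_X (infixl "[+]" 65) where "x [+] y \<equiv> addv X x y"
abbreviation minus_X (infixl "[-]" 65) where "x [-] y \<equiv> minusv X x y"
abbreviation scale_X (infixr "[*]" 75) where "r [*] x \<equiv> scalev X r x"
abbreviation le_X (infix "[\<le>]" 50) where "x [\<le>] y \<equiv> lev X x y"
abbreviation abs_X ("[\<bar>_\<bar>]") where "[\<bar>x\<bar>] \<equiv> absv X x"
abbreviation sup_X (infixl "[\<squnion>]" 65) where "x [\<squnion>] y \<equiv> supv X x y"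
abbreviation inf_X (infixl "[\<sqinter>]" 65) where "x [\<sqinter>] y \<equiv> infv X x y"
abbreviation C where "C \<equiv> carrierv X"
abbreviation zero_X ("[0]") where "[0] \<equiv> zerov X"

lemma add_left_commute:
  "\<lbrakk>x \<in> C; y \<in> C; z \<in> C\<rbrakk> \<Longrightarrow> x [+] (y [+] z) = y [+] (x [+] z)"
  by (metis add_assoc add_commute)

lemmas add_ac = add_assoc add_commute add_left_commute

lemma add_left_cancel:
  assumes "x \<in> C" "y \<in> C" "z \<in> C" "x [+] y = x [+] z"
  shows "y = z"
proof -
  obtain w where w: "w \<in> C" "x [+] w = [0]" using add_inverse assms by blast
  have "w [+] (x [+] v) = v" if "v \<in> C" for v
    using that w assms(1) add_assoc add_commute add_zero zero_closed by metis
  then show ?thesis using assms by metis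
qed

lemma zero_add: "x \<in> C \<Longrightarrow> [0] [+] x = x"
  using add_zero add_commute zero_closed by metis

lemma scale_0: assumes "x \<in> C" shows "0 [*] x = [0]"
proof -
  have "0 [*] x [+] 0 [*] x = 0 [*] x [+] [0]"
    using assms scale_add_left[of x 0 0] add_zero scale_closed by simp
  then show ?thesis using add_left_cancel assms scale_closed zero_closed by meson
qed

lemma scale_zero: "r [*] [0] = [0]"
  using scale_scale[of "[0]" r 0] scale_0 zero_closed by simp

lemma minus_self: "x \<in> C \<Longrightarrow> x [-] x = [0]"
  unfolding minusv_def using scale_add_left[of x 1 "-1"] scale_0 scale_one by simp

lemma minus_closed: "\<lbrakk>x \<in> C; y \<in> C\<rbrakk> \<Longrightarrow> x [-] y \<in> C"
  by (simp add: minusv_def add_closed scale_closed)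

lemmas closed = zero_closed add_closed scale_closed minus_closed

lemma add_neg_cancel:
  "\<lbrakk>x \<in> C; y \<in> C\<rbrakk> \<Longrightarrow> x [+] ((- 1) [*] x [+] y) = y"
  using add_assoc[of x "(-1) [*] x" y] minus_self[of x] zero_add closed
  by (simp add: minusv_def)

lemma minus_add_cancel: "\<lbrakk>x \<in> C; y \<in> C\<rbrakk> \<Longrightarrow> (x [-] y) [+] y = x"
  using minus_self[of y] add_commute[of "(- 1) [*] y" y]
  by (simp add: minusv_def add_assoc closed add_zero)

lemma add_minus_cancel: "\<lbrakk>x \<in> C; y \<in> C\<rbrakk> \<Longrightarrow> (x [+] y) [-] y = x"
  using minus_self[of y] by (simp add: minusv_def add_assoc closed add_zero)

lemma minus_zero: "x \<in> C \<Longrightarrow> x [-] [0] = x"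
  by (simp add: minusv_def scale_zero add_zero)

lemma minus_add_minus:
  "\<lbrakk>x \<in> C; y \<in> C; x' \<in> C; y' \<in> C\<rbrakk> \<Longrightarrow> (x [+] y) [-] (x' [+] y') = (x [-] x') [+] (y [-] y')"
  by (simp add: minusv_def scale_add_right add_ac closed)

lemma scale_minus_right:
  "\<lbrakk>x \<in> C; y \<in> C\<rbrakk> \<Longrightarrow> r [*] (x [-] y) = r [*] x [-] r [*] y"
  by (simp add: minusv_def scale_add_right scale_scale closed)

lemma neg_minus:
  "\<lbrakk>x \<in> C; y \<in> C\<rbrakk> \<Longrightarrow> (- 1) [*] (x [-] y) = y [-] x"
  by (simp add: minusv_def scale_add_right scale_scale closed scale_one add_commute)

lemma minus_trans_add:
  "\<lbrakk>x \<in> C; y \<in> C; z \<in> C\<rbrakk> \<Longrightarrow> (x [-] y) [+] (y [-] z) = x [-] z"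
  using minus_add_cancel[of x y] by (simp add: minusv_def add_assoc[symmetric] closed)

lemma minus_eq_zero:
  assumes "x \<in> C" "y \<in> C" "x [-] y = [0]"
  shows "x = y"
  using minus_add_cancel[of x y] zero_add assms by simp

lemma le_add_iff:
  assumes "x \<in> C" "y \<in> C" "z \<in> C"
  shows "x [+] z [\<le>] y [+] z \<longleftrightarrow> x [\<le>] y"
proof
  assume "x [+] z [\<le>] y [+] z"
  then have "(x [+] z) [+] (- 1) [*] z [\<le>] (y [+] z) [+] (- 1) [*] z"
    using assms closed by (intro le_add[of "x [+] z"]) auto
  then show "x [\<le>] y"
    unfolding minusv_def[symmetric] add_minus_cancel[OF assms(1,3)] add_minus_cancel[OF assms(2,3)] .
qed (use assms le_add in blast)

lemma le_add_both:
  assumes "x \<in> C" "y \<in> C" "x' \<in> C" "y' \<in> C" "x [\<le>] y" "x' [\<le>] y'"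
  shows "x [+] x' [\<le>] y [+] y'"
proof (rule le_trans[of _ "y [+] x'"])
  show "y [+] x' [\<le>] y [+] y'"
    using le_add[of x' y' y] assms by (simp add: add_commute)
qed (use assms le_add closed in auto)

lemma minus_le_iff:
  assumes "x \<in> C" "y \<in> C" "w \<in> C"
  shows "x [-] y [\<le>] w \<longleftrightarrow> x [\<le>] y [+] w"
  using le_add_iff[of "x [-] y" w y] assms closed minus_add_cancel by (simp add: add_commute)

lemma is_supv_unique: "\<lbrakk>is_supv X x y s; is_supv X x y t\<rbrakk> \<Longrightarrow> s = t"
  unfolding is_supv_def by (meson le_antisym)

lemma is_infv_unique: "\<lbrakk>is_infv X x y s; is_infv X x y t\<rbrakk> \<Longrightarrow> s = t"
  unfolding is_infv_def by (meson le_antisym)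

lemma supv_eqI: "is_supv X x y s \<Longrightarrow> x [\<squnion>] y = s"
  unfolding supv_def using is_supv_unique by blast

lemma infv_eqI: "is_infv X x y s \<Longrightarrow> x [\<sqinter>] y = s"
  unfolding infv_def using is_infv_unique by blast

lemma is_supv_supv: "\<lbrakk>x \<in> C; y \<in> C\<rbrakk> \<Longrightarrow> is_supv X x y (x [\<squnion>] y)"
  using sup_exists supv_eqI by metis

lemma is_infv_infv: "\<lbrakk>x \<in> C; y \<in> C\<rbrakk> \<Longrightarrow> is_infv X x y (x [\<sqinter>] y)"
  using inf_exists infv_eqI by metis

lemma
  assumes "x \<in> C" "y \<in> C"
  shows sup_closed: "x [\<squnion>] y \<in> C"
    and sup_ge1: "x [\<le>] x [\<squnion>] y"
    and sup_ge2: "y [\<le>] x [\<squnion>] y"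
    and sup_least: "\<lbrakk>u \<in> C; x [\<le>] u; y [\<le>] u\<rbrakk> \<Longrightarrow> x [\<squnion>] y [\<le>] u"
  using is_supv_supv[OF assms] unfolding is_supv_def by auto

lemma sup_absorb: "\<lbrakk>x \<in> C; y \<in> C; x [\<le>] y\<rbrakk> \<Longrightarrow> x [\<squnion>] y = y"
  by (rule supv_eqI) (simp add: is_supv_def le_refl)

lemma inf_absorb: "\<lbrakk>x \<in> C; y \<in> C; x [\<le>] y\<rbrakk> \<Longrightarrow> x [\<sqinter>] y = x"
  by (rule infv_eqI) (simp add: is_infv_def le_refl)

lemma sup_add:
  assumes "x \<in> C" "y \<in> C" "z \<in> C"
  shows "(x [+] z) [\<squnion>] (y [+] z) = (x [\<squnion>] y) [+] z"
proof (rule supv_eqI)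
  have "(x [\<squnion>] y) [+] z [\<le>] u"
    if u: "u \<in> C" "x [+] z [\<le>] u" "y [+] z [\<le>] u" for u
  proof -
    have "u = (u [-] z) [+] z" using assms u minus_add_cancel by simp
    then have "x [\<le>] u [-] z" "y [\<le>] u [-] z"
      using le_add_iff[of x "u [-] z" z] le_add_iff[of y "u [-] z" z] assms u closed by auto
    then show ?thesis
      using sup_least le_add[of "x [\<squnion>] y" "u [-] z" z] sup_closed minus_add_cancel assms u closed
      by simp
  qed
  then show "is_supv X (x [+] z) (y [+] z) ((x [\<squnion>] y) [+] z)"
    unfolding is_supv_def using assms closed sup_closed sup_ge1 sup_ge2 le_add by auto
qed

text \<open>This reduces suprema of differences to suprema, so that differences of suprema of finite
  sets are closed under the lattice operations.\<close>

lemma sup_minus: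
  assumes "a \<in> C" "b \<in> C" "c \<in> C" "d \<in> C"
  shows "(a [-] b) [\<squnion>] (c [-] d) = ((a [+] d) [\<squnion>] (c [+] b)) [-] (b [+] d)"
proof -
  have "((a [+] d) [\<squnion>] (c [+] b)) [-] (b [+] d)
      = ((a [+] d) [-] (b [+] d)) [\<squnion>] ((c [+] b) [-] (b [+] d))"
    unfolding minusv_def using assms closed sup_add by simp
  moreover have "(a [+] d) [-] (b [+] d) = a [-] b" "(c [+] b) [-] (b [+] d) = c [-] d"
    using minus_add_minus[of a d b d] minus_add_minus[of c b d b]
    by (simp_all add: assms closed minus_self add_zero add_commute[of b d])
  ultimately show ?thesis by simp
qed

lemma inf_eq_neg_sup:
  assumes "x \<in> C" "y \<in> C"
  shows "x [\<sqinter>] y = (- 1) [*] ((- 1) [*] x [\<squnion>] (- 1) [*] y)"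
proof (rule infv_eqI)
  have neg_le: "(- 1) [*] v [\<le>] (- 1) [*] u" if "u \<in> C" "v \<in> C" "u [\<le>] v" for u v
  proof -
    have "u [+] ((-1) [*] u [+] (-1) [*] v) [\<le>] v [+] ((-1) [*] u [+] (-1) [*] v)"
      using that closed by (intro le_add) auto
    then show ?thesis
      using add_neg_cancel[of u "(-1) [*] v"] add_neg_cancel[of v "(-1) [*] u"]
      by (simp add: that closed add_commute)
  qed
  have neg_neg: "(- 1) [*] (- 1) [*] u = u" if "u \<in> C" for u
    using that by (simp add: scale_scale scale_one)
  let ?s = "(- 1) [*] x [\<squnion>] (- 1) [*] y"
  have s: "?s \<in> C" "(- 1) [*] x [\<le>] ?s" "(- 1) [*] y [\<le>] ?s"
    using sup_closed sup_ge1 sup_ge2 assms closed by auto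
  have "(- 1) [*] ?s [\<le>] x" "(- 1) [*] ?s [\<le>] y"
    using neg_le[OF _ s(1) s(2)] neg_le[OF _ s(1) s(3)] neg_neg assms closed by auto
  moreover have "u [\<le>] (- 1) [*] ?s" if "u \<in> C" "u [\<le>] x" "u [\<le>] y" for u
  proof -
    have "?s [\<le>] (- 1) [*] u"
      using that assms closed neg_le by (intro sup_least) auto
    then show ?thesis using neg_le[of ?s "(- 1) [*] u"] neg_neg that s closed by auto
  qed
  ultimately show "is_infv X x y ((- 1) [*] ?s)"
    unfolding is_infv_def using s closed by auto
qed

lemma abs_closed: "x \<in> C \<Longrightarrow> [\<bar>x\<bar>] \<in> C"
  and abs_ge_self: "x \<in> C \<Longrightarrow> x [\<le>] [\<bar>x\<bar>]"
  and abs_ge_minus_self: "x \<in> C \<Longrightarrow> (- 1) [*] x [\<le>] [\<bar>x\<bar>]"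
  and abs_least: "\<lbrakk>x \<in> C; u \<in> C; x [\<le>] u; (- 1) [*] x [\<le>] u\<rbrakk> \<Longrightarrow> [\<bar>x\<bar>] [\<le>] u"
  unfolding absv_def using sup_closed sup_ge1 sup_ge2 sup_least closed by auto

lemma abs_nonneg: assumes "x \<in> C" shows "[0] [\<le>] [\<bar>x\<bar>]"
proof -
  have "x [+] (- 1) [*] x [\<le>] [\<bar>x\<bar>] [+] [\<bar>x\<bar>]"
    using assms abs_closed abs_ge_self abs_ge_minus_self closed by (intro le_add_both) auto
  then have "(1/2) [*] [0] [\<le>] (1/2) [*] ([\<bar>x\<bar>] [+] [\<bar>x\<bar>])"
    using minus_self[of x] assms abs_closed closed by (intro le_scale) (auto simp: minusv_def)
  then show ?thesis
    using scale_add_left[of "[\<bar>x\<bar>]" "1/2" "1/2"] assms abs_closed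
    by (simp add: scale_zero scale_add_right scale_one)
qed

lemma abs_of_nonneg: assumes "x \<in> C" "[0] [\<le>] x" shows "[\<bar>x\<bar>] = x"
proof (rule le_antisym)
  have "[0] [+] (- 1) [*] x [\<le>] x [+] (- 1) [*] x" using assms closed by (intro le_add) auto
  then have "(- 1) [*] x [\<le>] [0]"
    using minus_self[of x] by (simp add: assms minusv_def zero_add closed)
  then have "(- 1) [*] x [\<le>] x" using le_trans[of _ "[0]" x] assms closed by auto
  then show "[\<bar>x\<bar>] [\<le>] x" using abs_least le_refl assms by blast
qed (use assms abs_closed abs_ge_self in auto)

end

context banach_lattice
begin

lemma norm_abs: assumes "x \<in> C" shows "normv X [\<bar>x\<bar>] = normv X x"
proof -
  have c: "[\<bar>x\<bar>] \<in> C" using abs_closed assms by blast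
  have "[\<bar>[\<bar>x\<bar>]\<bar>] = [\<bar>x\<bar>]" using abs_of_nonneg[OF c abs_nonneg[OF assms]] .
  then have "normv X [\<bar>x\<bar>] \<le> normv X x" "normv X x \<le> normv X [\<bar>x\<bar>]"
    using norm_mono[OF c assms] norm_mono[OF assms c] le_refl[OF c] by auto
  then show ?thesis by (rule order_antisym)
qed

lemma norm_le_of_abs_le:
  assumes "x \<in> C" "w \<in> C" "x [\<le>] w" "(- 1) [*] x [\<le>] w"
  shows "normv X x \<le> normv X w"
proof (rule norm_mono)
  show "[\<bar>x\<bar>] [\<le>] [\<bar>w\<bar>]"
    using le_trans[of "[\<bar>x\<bar>]" w "[\<bar>w\<bar>]"] abs_least abs_closed abs_ge_self assms by blast
qed (use assms in auto)

lemma norm_zero: "normv X [0] = 0"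
  using norm_eq_zero zero_closed by blast

lemma norm_nonneg: "x \<in> C \<Longrightarrow> 0 \<le> normv X x"
  using norm_triangle[of x "(-1) [*] x"] minus_self[of x] norm_scale[of x "-1"] norm_zero
  by (simp add: minusv_def scale_closed)

definition dist_X where "dist_X x y = normv X (x [-] y)"

lemma dist_commute: "\<lbrakk>x \<in> C; y \<in> C\<rbrakk> \<Longrightarrow> dist_X x y = dist_X y x"
  unfolding dist_X_def using norm_scale[of "x [-] y" "-1"] neg_minus closed by simp

lemma dist_triangle: "\<lbrakk>x \<in> C; y \<in> C; z \<in> C\<rbrakk> \<Longrightarrow> dist_X x z \<le> dist_X x y + dist_X y z"
  unfolding dist_X_def using norm_triangle[of "x [-] y" "y [-] z"] minus_trans_add closed by simp

lemma norm_le_dist: "\<lbrakk>x \<in> C; y \<in> C\<rbrakk> \<Longrightarrow> normv X x \<le> dist_X x y + normv X y"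
  unfolding dist_X_def using norm_triangle[of "x [-] y" y] minus_add_cancel closed by simp

lemma dist_add:
  "\<lbrakk>x \<in> C; y \<in> C; x' \<in> C; y' \<in> C\<rbrakk> \<Longrightarrow> dist_X (x [+] y) (x' [+] y') \<le> dist_X x x' + dist_X y y'"
  unfolding dist_X_def using norm_triangle minus_add_minus closed by simp

lemma dist_scale: "\<lbrakk>x \<in> C; y \<in> C\<rbrakk> \<Longrightarrow> dist_X (r [*] x) (r [*] y) = \<bar>r\<bar> * dist_X x y"
  unfolding dist_X_def using norm_scale scale_minus_right closed by metis

lemma dist_sup:
  assumes "x \<in> C" "y \<in> C" "x' \<in> C" "y' \<in> C"
  shows "dist_X (x [\<squnion>] y) (x' [\<squnion>] y') \<le> dist_X x x' + dist_X y y'"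
proof -
  define w where "w = [\<bar>x [-] x'\<bar>] [+] [\<bar>y [-] y'\<bar>]"
  have w: "w \<in> C" unfolding w_def using assms closed abs_closed by simp
  have nw: "normv X w \<le> dist_X x x' + dist_X y y'"
    unfolding w_def dist_X_def using norm_triangle norm_abs assms closed abs_closed by metis
  have summand: "u [\<le>] u [+] v" "u [\<le>] v [+] u" if "u \<in> C" "v \<in> C" "[0] [\<le>] v" for u v
    using that le_add[of "[0]" v u] zero_closed zero_add add_commute by auto
  have abs_w: "[\<bar>x [-] x'\<bar>] [\<le>] w" "[\<bar>y [-] y'\<bar>] [\<le>] w"
    unfolding w_def using summand abs_nonneg abs_closed closed assms by auto
  have d: "x [-] x' [\<le>] w" "x' [-] x [\<le>] w" "y [-] y' [\<le>] w" "y' [-] y [\<le>] w"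
    using le_trans[OF _ _ w _ abs_w(1)] le_trans[OF _ _ w _ abs_w(2)]
      abs_ge_self abs_ge_minus_self[of "x [-] x'"] abs_ge_minus_self[of "y [-] y'"]
      neg_minus abs_closed closed assms by auto
  have le: "u [\<squnion>] v [\<le>] (u' [\<squnion>] v') [+] w"
    if uv: "u \<in> C" "v \<in> C" "u' \<in> C" "v' \<in> C" and "u [-] u' [\<le>] w" "v [-] v' [\<le>] w" for u v u' v'
  proof (rule sup_least)
    have "u [\<le>] u' [+] w" "v [\<le>] v' [+] w" using that w minus_le_iff by auto
    moreover have "u' [+] w [\<le>] (u' [\<squnion>] v') [+] w" "v' [+] w [\<le>] (u' [\<squnion>] v') [+] w"
      using uv w sup_closed sup_ge1 sup_ge2 le_add by auto
    ultimately show "u [\<le>] (u' [\<squnion>] v') [+] w" "v [\<le>] (u' [\<squnion>] v') [+] w"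
      using le_trans uv w sup_closed closed by meson+
  qed (use uv w sup_closed closed in auto)
  have "(x [\<squnion>] y) [-] (x' [\<squnion>] y') [\<le>] w" "(x' [\<squnion>] y') [-] (x [\<squnion>] y) [\<le>] w"
    using le d assms w sup_closed minus_le_iff by auto
  then have "dist_X (x [\<squnion>] y) (x' [\<squnion>] y') \<le> normv X w"
    unfolding dist_X_def using assms w sup_closed closed neg_minus by (intro norm_le_of_abs_le) auto
  then show ?thesis using nw by linarith
qed

end

section \<open>Weighted norms of finitely supported vectors\<close>

text \<open>For \<open>x\<close> of infinite support the sum is taken over an infinite set, so it is 0. All functions below
  therefore vanish outside the finitely supported vectors, without a restriction of their domain.\<close>

definition pairing :: "('a \<Rightarrow> real) \<Rightarrow> ('a \<Rightarrow> real) \<Rightarrow> real" where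
  "pairing l x = (\<Sum>a | x a \<noteq> 0. l a * x a)"

abbreviation weighted_norm :: "('a \<Rightarrow> real) \<Rightarrow> ('a \<Rightarrow> real) \<Rightarrow> real" where
  "weighted_norm c x \<equiv> pairing c (\<lambda>a. \<bar>x a\<bar>)"

definition l1_ball :: "'a set \<Rightarrow> real \<Rightarrow> ('a \<Rightarrow> real) set" where
  "l1_ball A r = {c. (\<forall>a. 0 \<le> c a) \<and> (\<forall>a. a \<notin> A \<longrightarrow> c a = 0) \<and> (\<forall>F. finite F \<longrightarrow> sum c F \<le> r)}"

lemma pairing_add: "pairing (\<lambda>a. l a + m a) x = pairing l x + pairing m x"
  by (simp add: pairing_def distrib_right sum.distrib)

lemma pairing_scale: "pairing (\<lambda>a. r * l a) x = r * pairing l x"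
  by (simp add: pairing_def sum_distrib_left mult.assoc)

lemma pairing_zero: "pairing (\<lambda>a. 0) x = 0"
  by (simp add: pairing_def)

lemma pairing_infinite: "infinite {a. x a \<noteq> 0} \<Longrightarrow> pairing l x = 0"
  by (simp add: pairing_def)

lemma pairing_eq_sum:
  assumes "finite S" "{a. x a \<noteq> 0} \<subseteq> S"
  shows "pairing l x = (\<Sum>a\<in>S. l a * x a)"
  unfolding pairing_def by (rule sum.mono_neutral_left) (use assms in auto)

lemma pairing_restrict:
  assumes "finite {a. x a \<noteq> 0}" "\<And>a. a \<notin> S \<Longrightarrow> l a = 0"
  shows "pairing l (\<lambda>a. if a \<in> S then x a else 0) = pairing l x"
proof -
  have "pairing l (\<lambda>a. if a \<in> S then x a else 0)
      = (\<Sum>a | x a \<noteq> 0. l a * (if a \<in> S then x a else 0))"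
    by (rule pairing_eq_sum) (use assms in auto)
  also have "\<dots> = pairing l x"
    unfolding pairing_def by (rule sum.cong) (use assms(2) in auto)
  finally show ?thesis .
qed

lemma weighted_norm_mono: "(\<And>a. c a \<le> d a) \<Longrightarrow> weighted_norm c x \<le> weighted_norm d x"
  unfolding pairing_def by (intro sum_mono mult_right_mono) auto

lemma weighted_norm_nonneg: "(\<And>a. 0 \<le> c a) \<Longrightarrow> 0 \<le> weighted_norm c x"
  unfolding pairing_def by (intro sum_nonneg mult_nonneg_nonneg) auto

lemma abs_pairing_le: "\<bar>pairing l x\<bar> \<le> weighted_norm (\<lambda>a. \<bar>l a\<bar>) x"
  unfolding pairing_def by (rule order_trans[OF sum_abs]) (simp add: abs_mult)

lemma l1_ball_nonneg: "c \<in> l1_ball A r \<Longrightarrow> 0 \<le> c a"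
  by (simp add: l1_ball_def)

lemma l1_ball_radius_nonneg: "c \<in> l1_ball A r \<Longrightarrow> 0 \<le> r"
  unfolding l1_ball_def by (auto dest!: spec[of _ "{}"])

lemma zero_in_l1_ball: "0 \<le> r \<Longrightarrow> (\<lambda>a. 0) \<in> l1_ball A r"
  by (simp add: l1_ball_def)

lemma l1_ball_mono: "\<lbrakk>c \<in> l1_ball A r; r \<le> s\<rbrakk> \<Longrightarrow> c \<in> l1_ball A s"
  unfolding l1_ball_def by (auto intro: order_trans)

lemma l1_ball_add:
  "\<lbrakk>c \<in> l1_ball A r; d \<in> l1_ball A s\<rbrakk> \<Longrightarrow> (\<lambda>a. c a + d a) \<in> l1_ball A (r + s)"
  unfolding l1_ball_def by (auto simp: sum.distrib intro: add_mono)

lemma l1_ball_scale: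
  "\<lbrakk>c \<in> l1_ball A r; 0 \<le> k\<rbrakk> \<Longrightarrow> (\<lambda>a. k * c a) \<in> l1_ball A (k * r)"
  unfolding l1_ball_def by (auto simp: sum_distrib_left[symmetric] intro: mult_left_mono)

lemma weighted_norm_le_of_l1_ball:
  assumes "c \<in> l1_ball A r"
  shows "weighted_norm c x \<le> r * (\<Sum>a | x a \<noteq> 0. \<bar>x a\<bar>)"
proof -
  have "c a \<le> r" for a
    using assms unfolding l1_ball_def by (auto dest!: spec[of _ "{a}"])
  then have "weighted_norm c x \<le> (\<Sum>a | x a \<noteq> 0. r * \<bar>x a\<bar>)"
    unfolding pairing_def by (simp add: sum_mono mult_right_mono)
  then show ?thesis by (simp add: sum_distrib_left)
qed

lemma continuous_on_weighted_sum:
  fixes w :: "'a \<Rightarrow> real"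
  shows "continuous_on UNIV (\<lambda>c. \<Sum>a\<in>F. c a * w a)"
  by (intro continuous_intros continuous_on_product_coordinates)

lemma compact_cube: "compact {c :: 'a \<Rightarrow> real. \<forall>a. 0 \<le> c a \<and> c a \<le> r}"
proof -
  have "compactin (product_topology (\<lambda>_. euclidean) UNIV) (PiE UNIV (\<lambda>_::'a. {0..r}))"
    by (subst compactin_PiE) auto
  moreover have "PiE UNIV (\<lambda>_::'a. {0..r}) = {c. \<forall>a. 0 \<le> c a \<and> c a \<le> r}"
    by (auto simp: PiE_def)
  ultimately show ?thesis by (simp add: euclidean_product_topology)
qed

lemma compact_l1_ball: "compact (l1_ball A r)"
proof -
  have sub: "l1_ball A r \<subseteq> {c. \<forall>a. 0 \<le> c a \<and> c a \<le> r}"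
    unfolding l1_ball_def by (auto dest!: spec[of _ "{_}"])
  have "closed (l1_ball A r)"
  proof -
    have "closed {c :: 'a \<Rightarrow> real. 0 \<le> c a}" "closed {c :: 'a \<Rightarrow> real. c a = 0}" for a
      by (intro closed_Collect_le closed_Collect_eq continuous_on_product_coordinates
          continuous_on_const)+
    moreover have "closed {c :: 'a \<Rightarrow> real. sum c F \<le> r}" for F
      using continuous_on_weighted_sum[where F = F and w = "\<lambda>_. 1"]
      by (intro closed_Collect_le continuous_on_const) simp
    ultimately show ?thesis
      unfolding l1_ball_def by (intro closed_Collect_conj closed_Collect_all closed_Collect_imp) auto
  qed
  from compact_Int_closed[OF compact_cube this, of r] show ?thesis
    unfolding Int_absorb1[OF sub] .
qed

text \<open>Each condition \<open>t \<le> weighted_norm c x\<close> involves only finitely many coordinates of \<open>c\<close>, so it cuts out a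
  closed subset of the compact set \<open>l1_ball A r\<close>, and the finite intersection property applies.\<close>

lemma weighted_norm_compactness:
  assumes "\<And>E. \<lbrakk>finite E; E \<subseteq> K\<rbrakk> \<Longrightarrow> \<exists>c\<in>l1_ball A r. \<forall>(x, t)\<in>E. t \<le> weighted_norm c x"
  shows "\<exists>c\<in>l1_ball A r. \<forall>(x, t)\<in>K. t \<le> weighted_norm c x"
proof -
  define B where "B = (\<lambda>(x, t). {c :: 'a \<Rightarrow> real. t \<le> weighted_norm c x})"
  have cl: "closed (B k)" for k
    unfolding B_def pairing_def
    by (cases k) (simp add: closed_Collect_le continuous_on_const continuous_on_weighted_sum)
  have "l1_ball A r \<inter> \<Inter>(B ` K) \<noteq> {}"
  proof (rule compact_imp_fip[OF compact_l1_ball])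
    fix G assume "finite G" "G \<subseteq> B ` K"
    then obtain E where "finite E" "E \<subseteq> K" "G = B ` E" by (meson finite_subset_image)
    then show "l1_ball A r \<inter> \<Inter>G \<noteq> {}" using assms[of E] unfolding B_def by fastforce
  qed (use cl in auto)
  then show ?thesis unfolding B_def by fastforce
qed

text \<open>Take the point \<open>m\<close> of the convex hull of \<open>Q\<close> closest to \<open>l\<close> in the Euclidean norm. If \<open>p = l - m\<close>, then
  minimality gives \<open>\<langle>p, q - m\<rangle> \<le> 0\<close> for all \<open>q\<close> in \<open>Q\<close>, while the hypothesis at \<open>x = p\<close> gives
  \<open>\<langle>p, l\<rangle> \<le> \<langle>p, q\<rangle>\<close> for some \<open>q\<close>. Together \<open>\<langle>p, p\<rangle> \<le> 0\<close>, so \<open>l = m\<close>.\<close>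

lemma convex_combination_if_le_Max:
  fixes l :: "'a \<Rightarrow> real"
  assumes Q: "finite Q" "\<And>q. q \<in> Q \<Longrightarrow> finite {a. q a \<noteq> 0}"
    and l: "finite {a. l a \<noteq> 0}"
    and le: "\<And>x. \<exists>q\<in>Q. pairing l x \<le> pairing q x"
  shows "\<exists>t. (\<forall>q\<in>Q. 0 \<le> t q) \<and> sum t Q = 1 \<and> (\<forall>a. l a = (\<Sum>q\<in>Q. t q * q a))"
proof -
  define S where "S = {a. l a \<noteq> 0} \<union> (\<Union>q\<in>Q. {a. q a \<noteq> 0})"
  have S: "finite S" "\<And>a. a \<notin> S \<Longrightarrow> l a = 0" "\<And>a q. \<lbrakk>a \<notin> S; q \<in> Q\<rbrakk> \<Longrightarrow> q a = 0"
    unfolding S_def using Q l by auto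
  define m where "m = (\<lambda>t a. \<Sum>q\<in>Q. t q * q a)"
  define d where "d = (\<lambda>t. \<Sum>a\<in>S. (l a - m t a)\<^sup>2)"
  define K where "K = {t :: ('a \<Rightarrow> real) \<Rightarrow> real. \<forall>q. 0 \<le> t q \<and> t q \<le> 1} \<inter> {t. sum t Q = 1}"
  have "closed {t :: ('a \<Rightarrow> real) \<Rightarrow> real. sum t Q = 1}"
    using continuous_on_weighted_sum[where F = Q and w = "\<lambda>_. 1"] by (intro closed_Collect_eq continuous_on_const) simp
  then have "compact K" unfolding K_def using compact_cube compact_Int_closed by blast
  moreover obtain q0 where q0: "q0 \<in> Q" using le by blast
  have "(\<lambda>q. if q = q0 then 1 else 0) \<in> K" unfolding K_def using q0 Q(1) by (simp add: sum.delta)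
  then have "K \<noteq> {}" by blast
  moreover have "continuous_on K d"
    unfolding d_def m_def
    by (intro continuous_intros continuous_on_subset[OF continuous_on_weighted_sum]) auto
  ultimately obtain t where t: "t \<in> K" "\<And>s. s \<in> K \<Longrightarrow> d t \<le> d s"
    using continuous_attains_inf by metis
  define p where "p = (\<lambda>a. l a - m t a)"
  have descent: "(\<Sum>a\<in>S. p a * (q a - m t a)) \<le> 0" if q: "q \<in> Q" for q
  proof (rule ccontr)
    define G where "G = (\<Sum>a\<in>S. p a * (q a - m t a))"
    define B where "B = (\<Sum>a\<in>S. (q a - m t a)\<^sup>2)"
    assume "\<not> (\<Sum>a\<in>S. p a * (q a - m t a)) \<le> 0"
    then have G: "0 < G" unfolding G_def by simp
    have B: "0 \<le> B" unfolding B_def by (simp add: sum_nonneg)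
    \<comment> \<open>Moving from \<open>t\<close> towards the vertex \<open>q\<close> by \<open>s\<close> changes \<open>d\<close> by \<open>s\<^sup>2 * B - 2 * s * G\<close>, which is negative.\<close>
    define s where "s = min 1 (G / (B + 1))"
    have s: "0 < s" "s \<le> 1" "s * B < 2 * G"
    proof -
      show "0 < s" "s \<le> 1" unfolding s_def using G B by auto
      have "s * B \<le> G / (B + 1) * B" unfolding s_def using B by (intro mult_right_mono) auto
      also have "\<dots> = G * (B / (B + 1))" by simp
      also have "\<dots> \<le> G * 1" using G B by (intro mult_left_mono) auto
      finally show "s * B < 2 * G" using G by simp
    qed
    define t' where "t' = (\<lambda>q'. (1 - s) * t q' + s * (if q' = q then 1 else 0))"
    have "t' \<in> K"
    proof -
      have "sum t' Q = (1 - s) * sum t Q + s * (\<Sum>q'\<in>Q. if q' = q then 1 else 0)"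
        unfolding t'_def by (simp add: sum.distrib sum_distrib_left)
      moreover have "0 \<le> t' q'" "t' q' \<le> 1" for q'
      proof -
        have "0 \<le> t q'" "t q' \<le> 1" using t(1) unfolding K_def by auto
        then have "0 \<le> (1 - s) * t q'" "(1 - s) * t q' \<le> (1 - s) * 1"
          using s by (intro mult_nonneg_nonneg mult_left_mono; simp)+
        then show "0 \<le> t' q'" "t' q' \<le> 1" unfolding t'_def using s by auto
      qed
      ultimately show ?thesis
        using t(1) q Q(1) unfolding K_def by (simp add: sum.delta)
    qed
    have "m t' a = (1 - s) * m t a + s * q a" for a
    proof -
      have "m t' a = (\<Sum>q'\<in>Q. (1 - s) * (t q' * q' a) + s * (if q' = q then q' a else 0))"
        unfolding m_def t'_def by (rule sum.cong) (auto simp: algebra_simps)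
      also have "\<dots> = (1 - s) * m t a + s * (\<Sum>q'\<in>Q. if q' = q then q' a else 0)"
        unfolding m_def by (simp only: sum.distrib sum_distrib_left)
      finally show ?thesis using q Q(1) by (simp add: sum.delta)
    qed
    then have residual: "l a - m t' a = p a - s * (q a - m t a)" for a
      unfolding p_def by (simp add: algebra_simps)
    have "d t' = (\<Sum>a\<in>S. (p a - s * (q a - m t a))\<^sup>2)"
      unfolding d_def by (simp only: residual)
    also have "\<dots> = (\<Sum>a\<in>S. (p a)\<^sup>2 - 2 * s * (p a * (q a - m t a)) + s\<^sup>2 * (q a - m t a)\<^sup>2)"
      by (intro sum.cong) (simp_all add: power2_eq_square algebra_simps)
    also have "\<dots> = d t - 2 * s * G + s\<^sup>2 * B"
      unfolding d_def G_def B_def p_def by (simp only: sum.distrib sum_subtractf sum_distrib_left)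
    finally have "2 * s * G \<le> s\<^sup>2 * B" using t(2)[OF \<open>t' \<in> K\<close>] by simp
    then have "s * (2 * G) \<le> s * (s * B)" by (simp add: power2_eq_square algebra_simps)
    then show False using s by simp
  qed
  have p0: "p a = 0" if "a \<notin> S" for a
    unfolding p_def m_def using S(2,3) that by (simp add: sum.neutral)
  then have supp: "{a. p a \<noteq> 0} \<subseteq> S" by auto
  obtain q where q: "q \<in> Q" "pairing l p \<le> pairing q p" using le by blast
  have "(\<Sum>a\<in>S. l a * p a) \<le> (\<Sum>a\<in>S. q a * p a)"
    using q(2) unfolding pairing_eq_sum[of S p, OF S(1) supp] .
  moreover have "(\<Sum>a\<in>S. (p a)\<^sup>2) = (\<Sum>a\<in>S. l a * p a) - (\<Sum>a\<in>S. m t a * p a)"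
    unfolding sum_subtractf[symmetric] by (rule sum.cong) (auto simp: p_def power2_eq_square algebra_simps)
  moreover have "(\<Sum>a\<in>S. q a * p a) - (\<Sum>a\<in>S. m t a * p a) \<le> 0"
    using descent[OF q(1)] unfolding sum_subtractf[symmetric] by (simp add: algebra_simps)
  ultimately have "(\<Sum>a\<in>S. (p a)\<^sup>2) \<le> 0" by linarith
  then have "(\<Sum>a\<in>S. (p a)\<^sup>2) = 0" by (simp add: order_antisym sum_nonneg)
  then have "p a = 0" for a using p0 S(1) by (cases "a \<in> S") (auto simp: sum_nonneg_eq_0_iff)
  then have "l a = (\<Sum>q\<in>Q. t q * q a)" for a unfolding p_def m_def by simp
  then show ?thesis using t(1) unfolding K_def by auto
qed

section \<open>Maxima of linear forms\<close>

lemma pairing_single: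
  "pairing (\<lambda>b. if b = a then k else 0) x = (if finite {a. x a \<noteq> 0} then k * x a else 0)"
proof (cases "finite {a. x a \<noteq> 0}")
  case True
  then have "pairing (\<lambda>b. if b = a then k else 0) x
      = (\<Sum>b\<in>insert a {a. x a \<noteq> 0}. (if b = a then k else 0) * x b)"
    by (intro pairing_eq_sum) auto
  also have "\<dots> = (\<Sum>b\<in>insert a {a. x a \<noteq> 0}. if b = a then k * x b else 0)"
    by (rule sum.cong) auto
  also have "\<dots> = k * x a" using True by (subst sum.delta) auto
  finally show ?thesis using True by simp
qed (simp add: pairing_infinite)

context banach_lattice
begin

abbreviation add_monoid_X where
  "add_monoid_X \<equiv> \<lparr>carrier = C, monoid.mult = addv X, one = zerov X\<rparr>"

definition unit_ball where "unit_ball = {a \<in> C. normv X a \<le> 1}"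

definition forms where "forms = {l. finite {a. l a \<noteq> 0} \<and> {a. l a \<noteq> (0::real)} \<subseteq> unit_ball}"

text \<open>The value of a linear form when the coordinate of \<open>a\<close> is replaced by the lattice element \<open>a\<close> itself.\<close>

definition evaluate where
  "evaluate l = finprod add_monoid_X (\<lambda>a. l a [*] a) {a. l a \<noteq> 0}"

interpretation G: comm_monoid add_monoid_X
  by unfold_locales (auto simp: add_assoc add_zero zero_add closed intro: add_commute)

lemma evaluate_eq:
  assumes "finite F" "F \<subseteq> C" "{a. l a \<noteq> 0} \<subseteq> F"
  shows "evaluate l = finprod add_monoid_X (\<lambda>a. l a [*] a) F"
  unfolding evaluate_def
  by (rule G.finprod_mono_neutral_cong_left) (use assms scale_0 scale_closed in auto)

lemma formsD: "l \<in> forms \<Longrightarrow> finite {a. l a \<noteq> 0}" "l \<in> forms \<Longrightarrow> {a. l a \<noteq> 0} \<subseteq> C"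
  unfolding forms_def unit_ball_def by auto

lemma evaluate_closed: assumes "l \<in> forms" shows "evaluate l \<in> C"
proof -
  have "(\<lambda>a. l a [*] a) \<in> {a. l a \<noteq> 0} \<rightarrow> C" using formsD[OF assms] scale_closed by auto
  then show ?thesis using G.finprod_closed[of "\<lambda>a. l a [*] a" "{a. l a \<noteq> 0}"] by (simp add: evaluate_def)
qed

lemma forms_add: "\<lbrakk>l \<in> forms; m \<in> forms\<rbrakk> \<Longrightarrow> (\<lambda>a. l a + m a) \<in> forms"
proof -
  assume "l \<in> forms" "m \<in> forms"
  moreover have "{a. l a + m a \<noteq> 0} \<subseteq> {a. l a \<noteq> 0} \<union> {a. m a \<noteq> 0}" by auto
  ultimately show ?thesis
    unfolding forms_def by (auto intro: finite_subset[of _ "{a. l a \<noteq> 0} \<union> {a. m a \<noteq> 0}"])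
qed

lemma forms_scale: "l \<in> forms \<Longrightarrow> (\<lambda>a. r * l a) \<in> forms"
  unfolding forms_def by (auto intro: finite_subset[of _ "{a. l a \<noteq> 0}"])

lemma forms_zero: "(\<lambda>a. 0) \<in> forms"
  unfolding forms_def by simp

lemma forms_single: "a \<in> unit_ball \<Longrightarrow> (\<lambda>b. if b = a then k else 0) \<in> forms"
  unfolding forms_def by auto

lemma evaluate_add:
  assumes "l \<in> forms" "m \<in> forms"
  shows "evaluate (\<lambda>a. l a + m a) = evaluate l [+] evaluate m"
proof -
  let ?F = "{a. l a \<noteq> 0} \<union> {a. m a \<noteq> 0}"
  have F: "finite ?F" "?F \<subseteq> C" using assms formsD by auto
  have "evaluate (\<lambda>a. l a + m a) = finprod add_monoid_X (\<lambda>a. (l a + m a) [*] a) ?F"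
    by (rule evaluate_eq) (use F in auto)
  also have "\<dots> = finprod add_monoid_X (\<lambda>a. l a [*] a [+] m a [*] a) ?F"
    by (rule G.finprod_cong') (use F scale_add_left closed in auto)
  also have "\<dots> = finprod add_monoid_X (\<lambda>a. l a [*] a) ?F [+] finprod add_monoid_X (\<lambda>a. m a [*] a) ?F"
    using F G.finprod_multf[of "\<lambda>a. l a [*] a" ?F "\<lambda>a. m a [*] a"] scale_closed by auto
  also have "\<dots> = evaluate l [+] evaluate m"
    using evaluate_eq[of ?F l] evaluate_eq[of ?F m] F by simp
  finally show ?thesis .
qed

lemma evaluate_scale:
  assumes "l \<in> forms"
  shows "evaluate (\<lambda>a. r * l a) = r [*] evaluate l"
proof -
  have "finprod add_monoid_X (\<lambda>a. (r * l a) [*] a) F = r [*] finprod add_monoid_X (\<lambda>a. l a [*] a) F"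
    if "finite F" "F \<subseteq> C" for F
    using that
  proof (induction F)
    case empty
    then show ?case by (simp add: scale_zero)
  next
    case (insert a F)
    then have "(\<lambda>a. k a [*] a) \<in> F \<rightarrow> C" for k :: "'a \<Rightarrow> real" using scale_closed by auto
    moreover from this have "finprod add_monoid_X (\<lambda>a. l a [*] a) F \<in> C"
      using G.finprod_closed[of "\<lambda>a. l a [*] a" F] by simp
    ultimately show ?case
      using insert by (simp add: scale_closed scale_add_right scale_scale)
  qed
  then show ?thesis
    using evaluate_eq[of "{a. l a \<noteq> 0}" "\<lambda>a. r * l a"] formsD[OF assms] unfolding evaluate_def[of l] by auto
qed

lemma evaluate_zero: "evaluate (\<lambda>a. 0) = [0]"
  by (simp add: evaluate_def)

lemma evaluate_single:
  assumes "a \<in> unit_ball"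
  shows "evaluate (\<lambda>b. if b = a then 1 else 0) = a"
proof -
  have "a \<in> C" using assms unit_ball_def by auto
  then show ?thesis
    using evaluate_eq[of "{a}" "\<lambda>b. if b = a then 1 else 0"] by (simp add: scale_one add_zero)
qed

lemma evaluate_combination_le:
  assumes "finite Q" "Q \<subseteq> forms" "y \<in> C" "\<forall>q\<in>Q. 0 \<le> t q \<and> evaluate q [\<le>] y"
  shows "(\<lambda>a. \<Sum>q\<in>Q. t q * q a) \<in> forms \<and> evaluate (\<lambda>a. \<Sum>q\<in>Q. t q * q a) [\<le>] sum t Q [*] y"
  using assms
proof (induction Q)
  case empty
  then show ?case using forms_zero evaluate_zero scale_0 le_refl zero_closed by simp
next
  case (insert q Q)
  let ?c = "\<lambda>a. \<Sum>q\<in>Q. t q * q a"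
  have c: "?c \<in> forms" "evaluate ?c [\<le>] sum t Q [*] y" using insert by auto
  have q: "q \<in> forms" "(\<lambda>a. t q * q a) \<in> forms" using insert forms_scale by auto
  have "evaluate (\<lambda>a. t q * q a) [\<le>] t q [*] y"
    using insert.prems evaluate_scale[OF q(1)] le_scale[of "evaluate q" y "t q"] evaluate_closed[OF q(1)] by simp
  then have "evaluate (\<lambda>a. t q * q a) [+] evaluate ?c [\<le>] t q [*] y [+] sum t Q [*] y"
    using c evaluate_closed q insert.prems by (intro le_add_both scale_closed) auto
  moreover have "(\<lambda>a. \<Sum>q\<in>insert q Q. t q * q a) = (\<lambda>a. t q * q a + ?c a)"
    using insert.hyps by (simp add: sum.insert)
  ultimately show ?case
    using insert.hyps evaluate_add[OF q(2) c(1)] forms_add[OF q(2) c(1)] scale_add_left insert.prems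
    by simp
qed

text \<open>A convex combination of elements below \<open>y\<close> is below \<open>y\<close>, in any vector lattice.\<close>

lemma evaluate_le_if_le_Max:
  assumes "finite Q" "Q \<subseteq> forms" "l \<in> forms" "y \<in> C"
    and "\<And>q. q \<in> Q \<Longrightarrow> evaluate q [\<le>] y"
    and "\<And>x. \<exists>q\<in>Q. pairing l x \<le> pairing q x"
  shows "evaluate l [\<le>] y"
proof -
  obtain t where t: "\<forall>q\<in>Q. 0 \<le> t q" "sum t Q = 1" "\<forall>a. l a = (\<Sum>q\<in>Q. t q * q a)"
    using convex_combination_if_le_Max[of Q l] assms formsD by blast
  have "l = (\<lambda>a. \<Sum>q\<in>Q. t q * q a)" using t(3) by auto
  then show ?thesis
    using evaluate_combination_le[of Q y t] assms t scale_one by simp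
qed

definition is_lub where
  "is_lub E z \<longleftrightarrow> z \<in> C \<and> (\<forall>e\<in>E. e [\<le>] z) \<and> (\<forall>u\<in>C. (\<forall>e\<in>E. e [\<le>] u) \<longrightarrow> z [\<le>] u)"

text \<open>The function \<open>p\<close> is the pointwise maximum of finitely many linear forms whose values in the lattice
  have the supremum \<open>z\<close>.\<close>

definition max_form where
  "max_form p z \<longleftrightarrow> (\<exists>P. finite P \<and> P \<subseteq> forms \<and> (\<forall>x. \<exists>l\<in>P. p x = pairing l x) \<and>
     (\<forall>l\<in>P. \<forall>x. pairing l x \<le> p x) \<and> is_lub (evaluate ` P) z)"

lemma max_formE:
  assumes "max_form p z"
  obtains P where "finite P" "P \<subseteq> forms" "\<And>x. \<exists>l\<in>P. p x = pairing l x"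
    "\<And>l x. l \<in> P \<Longrightarrow> pairing l x \<le> p x" "z \<in> C" "\<And>l. l \<in> P \<Longrightarrow> evaluate l [\<le>] z"
    "\<And>u. \<lbrakk>u \<in> C; \<And>l. l \<in> P \<Longrightarrow> evaluate l [\<le>] u\<rbrakk> \<Longrightarrow> z [\<le>] u"
  using assms unfolding max_form_def is_lub_def by auto

lemma max_formI:
  assumes "finite P" "P \<subseteq> forms" "\<And>x. \<exists>l\<in>P. p x = pairing l x"
    "\<And>l x. l \<in> P \<Longrightarrow> pairing l x \<le> p x" "z \<in> C" "\<And>l. l \<in> P \<Longrightarrow> evaluate l [\<le>] z"
    "\<And>u. \<lbrakk>u \<in> C; \<And>l. l \<in> P \<Longrightarrow> evaluate l [\<le>] u\<rbrakk> \<Longrightarrow> z [\<le>] u"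
  shows "max_form p z"
  unfolding max_form_def is_lub_def using assms by (intro exI[of _ P]) auto

lemma max_form_closed: "max_form p z \<Longrightarrow> z \<in> C"
  by (elim max_formE)

text \<open>This makes the passage from functions to lattice elements well defined: pointwise equal maxima have
  equal suprema, even if they come from different sets of forms.\<close>

lemma max_form_mono:
  assumes "max_form p z" "max_form q y" "\<And>x. p x \<le> q x"
  shows "z [\<le>] y"
proof -
  obtain P where P: "P \<subseteq> forms" "\<And>l x. l \<in> P \<Longrightarrow> pairing l x \<le> p x"
    "\<And>u. \<lbrakk>u \<in> C; \<And>l. l \<in> P \<Longrightarrow> evaluate l [\<le>] u\<rbrakk> \<Longrightarrow> z [\<le>] u"
    using assms(1) by (elim max_formE) blast
  obtain Q where Q: "finite Q" "Q \<subseteq> forms" "\<And>x. \<exists>l\<in>Q. q x = pairing l x" "y \<in> C"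
    "\<And>l. l \<in> Q \<Longrightarrow> evaluate l [\<le>] y"
    using assms(2) by (elim max_formE) blast
  show ?thesis
  proof (rule P(3)[OF Q(4)])
    fix l assume l: "l \<in> P"
    have "\<exists>m\<in>Q. pairing l x \<le> pairing m x" for x
      using P(2)[OF l, of x] Q(3)[of x] assms(3)[of x] order_trans by fastforce
    then show "evaluate l [\<le>] y" using evaluate_le_if_le_Max[of Q l y] Q P(1) l by blast
  qed
qed

lemma max_form_pairing:
  assumes "l \<in> forms"
  shows "max_form (pairing l) (evaluate l)"
  by (rule max_formI[of "{l}"]) (use assms evaluate_closed le_refl in auto)

lemma max_form_scale:
  assumes "max_form p z" "0 \<le> r"
  shows "max_form (\<lambda>x. r * p x) (r [*] z)"
proof -
  obtain P where P: "finite P" "P \<subseteq> forms" "\<And>x. \<exists>l\<in>P. p x = pairing l x"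
    "\<And>l x. l \<in> P \<Longrightarrow> pairing l x \<le> p x" "z \<in> C" "\<And>l. l \<in> P \<Longrightarrow> evaluate l [\<le>] z"
    "\<And>u. \<lbrakk>u \<in> C; \<And>l. l \<in> P \<Longrightarrow> evaluate l [\<le>] u\<rbrakk> \<Longrightarrow> z [\<le>] u"
    using assms(1) by (elim max_formE) blast
  have ev: "evaluate (\<lambda>a. r * l a) = r [*] evaluate l" if "l \<in> P" for l using evaluate_scale P(2) that by auto
  show ?thesis
  proof (rule max_formI[of "(\<lambda>l a. r * l a) ` P"])
    fix u assume u: "u \<in> C" "\<And>l. l \<in> (\<lambda>l a. r * l a) ` P \<Longrightarrow> evaluate l [\<le>] u"
    show "r [*] z [\<le>] u"
    proof (cases "r = 0")
      case True
      obtain l where l: "l \<in> P" using P(3) by blast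
      then have "0 [*] evaluate l [\<le>] u" using u(2) ev True by fastforce
      then show ?thesis using True scale_0 P(2,5) l evaluate_closed by (metis subsetD)
    next
      case False
      then have r: "0 < r" using assms(2) by simp
      have inv: "(1/r) [*] r [*] v = v" "r [*] (1/r) [*] v = v" if "v \<in> C" for v
        using that r by (simp_all add: scale_scale scale_one)
      have "z [\<le>] (1/r) [*] u"
      proof (rule P(7))
        fix l assume l: "l \<in> P"
        then have "r [*] evaluate l [\<le>] u" using u(2) ev by fastforce
        then have "(1/r) [*] r [*] evaluate l [\<le>] (1/r) [*] u"
          using l P(2) u r evaluate_closed scale_closed by (intro le_scale) auto
        then show "evaluate l [\<le>] (1/r) [*] u" using inv evaluate_closed P(2) l by auto
      qed (use u scale_closed in auto)
      then have "r [*] z [\<le>] r [*] (1/r) [*] u" using r u P(5) scale_closed by (intro le_scale) auto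
      then show ?thesis using inv u by simp
    qed
  next
    show "\<exists>l\<in>(\<lambda>l a. r * l a) ` P. r * p x = pairing l x" for x
      using P(3)[of x] by (auto simp: pairing_scale)
  next
    show "evaluate l [\<le>] r [*] z" if "l \<in> (\<lambda>l a. r * l a) ` P" for l
      using that P ev le_scale evaluate_closed assms(2) by auto
  next
    show "pairing l x \<le> r * p x" if "l \<in> (\<lambda>l a. r * l a) ` P" for l x
      using that P(4) assms(2) by (auto simp: pairing_scale mult_left_mono)
  qed (use P forms_scale scale_closed in auto)
qed

text \<open>Both the maximum of functions and the supremum in the lattice turn Minkowski sums of sets into sums.\<close>

lemma max_form_add:
  assumes "max_form p z" "max_form q y"
  shows "max_form (\<lambda>x. p x + q x) (z [+] y)"
proof -
  obtain P where P: "finite P" "P \<subseteq> forms" "\<And>x. \<exists>l\<in>P. p x = pairing l x"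
    "\<And>l x. l \<in> P \<Longrightarrow> pairing l x \<le> p x" "z \<in> C" "\<And>l. l \<in> P \<Longrightarrow> evaluate l [\<le>] z"
    "\<And>u. \<lbrakk>u \<in> C; \<And>l. l \<in> P \<Longrightarrow> evaluate l [\<le>] u\<rbrakk> \<Longrightarrow> z [\<le>] u"
    using assms(1) by (elim max_formE) blast
  obtain Q where Q: "finite Q" "Q \<subseteq> forms" "\<And>x. \<exists>l\<in>Q. q x = pairing l x"
    "\<And>l x. l \<in> Q \<Longrightarrow> pairing l x \<le> q x" "y \<in> C" "\<And>l. l \<in> Q \<Longrightarrow> evaluate l [\<le>] y"
    "\<And>u. \<lbrakk>u \<in> C; \<And>l. l \<in> Q \<Longrightarrow> evaluate l [\<le>] u\<rbrakk> \<Longrightarrow> y [\<le>] u"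
    using assms(2) by (elim max_formE) blast
  let ?S = "(\<lambda>(l, m) a. l a + m a) ` (P \<times> Q)"
  have ev: "evaluate (\<lambda>a. l a + m a) = evaluate l [+] evaluate m" "evaluate l \<in> C" "evaluate m \<in> C"
    if "l \<in> P" "m \<in> Q" for l m using evaluate_add P(2) Q(2) that evaluate_closed by auto
  show ?thesis
  proof (rule max_formI[of ?S])
    fix u assume u: "u \<in> C" "\<And>l. l \<in> ?S \<Longrightarrow> evaluate l [\<le>] u"
    have "z [\<le>] u [-] y"
    proof (rule P(7))
      fix l assume l: "l \<in> P"
      have "y [\<le>] u [-] evaluate l"
      proof (rule Q(7))
        fix m assume m: "m \<in> Q"
        have "(\<lambda>a. l a + m a) \<in> ?S" using l m by force
        then have "evaluate m [+] evaluate l [\<le>] u"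
          using u(2) ev[OF l m] add_commute[of "evaluate m" "evaluate l"] by fastforce
        moreover have "u = (u [-] evaluate l) [+] evaluate l"
          using minus_add_cancel u ev(2)[OF l m] by simp
        ultimately show "evaluate m [\<le>] u [-] evaluate l"
          using le_add_iff[of "evaluate m" "u [-] evaluate l" "evaluate l"] ev(2,3)[OF l m] u closed by simp
      next
        obtain m where "m \<in> Q" using Q(3) by blast
        then show "u [-] evaluate l \<in> C" using ev(2)[OF l] u closed by auto
      qed
      moreover have el: "evaluate l \<in> C" using P(2) l evaluate_closed by blast
      ultimately have "evaluate l [+] y [\<le>] u"
        using le_add_iff[of y "u [-] evaluate l" "evaluate l"] minus_add_cancel[OF u(1) el]
          add_commute[OF el Q(5)] u closed Q(5) by simp
      then show "evaluate l [\<le>] u [-] y"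
        using le_add_iff[of "evaluate l" "u [-] y" y] minus_add_cancel[OF u(1) Q(5)] el u Q(5) closed
        by simp
    qed (use u Q(5) closed in auto)
    then show "z [+] y [\<le>] u"
      using le_add_iff[of z "u [-] y" y] minus_add_cancel[OF u(1) Q(5)] u P(5) Q(5) closed by simp
  next
    fix x
    obtain l m where "l \<in> P" "m \<in> Q" "p x = pairing l x" "q x = pairing m x"
      using P(3)[of x] Q(3)[of x] by blast
    then show "\<exists>l\<in>?S. p x + q x = pairing l x"
      by (intro bexI[of _ "\<lambda>a. l a + m a"]) (auto simp: pairing_add)
  next
    show "evaluate l [\<le>] z [+] y" if "l \<in> ?S" for l
      using that ev P(5,6) Q(5,6) by (auto intro!: le_add_both)
  next
    show "pairing l x \<le> p x + q x" if "l \<in> ?S" for l x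
      using that P(4) Q(4) by (auto simp: pairing_add intro!: add_mono)
  qed (use P(1,2,5) Q(1,2,5) forms_add closed in auto)
qed

lemma max_form_max:
  assumes "max_form p z" "max_form q y"
  shows "max_form (\<lambda>x. max (p x) (q x)) (z [\<squnion>] y)"
proof -
  obtain P where P: "finite P" "P \<subseteq> forms" "\<And>x. \<exists>l\<in>P. p x = pairing l x"
    "\<And>l x. l \<in> P \<Longrightarrow> pairing l x \<le> p x" "z \<in> C" "\<And>l. l \<in> P \<Longrightarrow> evaluate l [\<le>] z"
    "\<And>u. \<lbrakk>u \<in> C; \<And>l. l \<in> P \<Longrightarrow> evaluate l [\<le>] u\<rbrakk> \<Longrightarrow> z [\<le>] u"
    using assms(1) by (elim max_formE) blast
  obtain Q where Q: "finite Q" "Q \<subseteq> forms" "\<And>x. \<exists>l\<in>Q. q x = pairing l x"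
    "\<And>l x. l \<in> Q \<Longrightarrow> pairing l x \<le> q x" "y \<in> C" "\<And>l. l \<in> Q \<Longrightarrow> evaluate l [\<le>] y"
    "\<And>u. \<lbrakk>u \<in> C; \<And>l. l \<in> Q \<Longrightarrow> evaluate l [\<le>] u\<rbrakk> \<Longrightarrow> y [\<le>] u"
    using assms(2) by (elim max_formE) blast
  show ?thesis
  proof (rule max_formI[of "P \<union> Q"])
    show "\<exists>l\<in>P \<union> Q. max (p x) (q x) = pairing l x" for x
      using P(3)[of x] Q(3)[of x] by (cases "p x \<le> q x") auto
  next
    show "evaluate l [\<le>] z [\<squnion>] y" if "l \<in> P \<union> Q" for l
      using that
    proof
      assume l: "l \<in> P"
      then show ?thesis
        using le_trans[OF evaluate_closed P(5) sup_closed[OF P(5) Q(5)] P(6)[OF l] sup_ge1[OF P(5) Q(5)]]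
          P(2) by blast
    next
      assume l: "l \<in> Q"
      then show ?thesis
        using le_trans[OF evaluate_closed Q(5) sup_closed[OF P(5) Q(5)] Q(6)[OF l] sup_ge2[OF P(5) Q(5)]]
          Q(2) by blast
    qed
  next
    show "z [\<squnion>] y [\<le>] u" if "u \<in> C" "\<And>l. l \<in> P \<union> Q \<Longrightarrow> evaluate l [\<le>] u" for u
      using that P(5,7) Q(5,7) by (intro sup_least) auto
  next
    show "pairing l x \<le> max (p x) (q x)" if "l \<in> P \<union> Q" for l x
      using that P(4)[of l x] Q(4)[of l x] by auto
  qed (use P Q sup_closed in auto)
qed

lemma max_form_weighted_norm_single:
  assumes "a \<in> unit_ball" "0 \<le> k"
  shows "max_form (weighted_norm (\<lambda>b. if b = a then k else 0)) (k [*] [\<bar>a\<bar>])"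
proof -
  let ?d = "\<lambda>b. if b = a then 1 else (0::real)"
  have d: "?d \<in> forms" "(\<lambda>b. - 1 * ?d b) \<in> forms" "evaluate ?d = a" "evaluate (\<lambda>b. - 1 * ?d b) = (- 1) [*] a"
    using forms_single[OF assms(1)] forms_scale[of ?d "-1"] evaluate_single[OF assms(1)]
      evaluate_scale[of ?d "-1"] by simp_all
  have "max_form (\<lambda>x. k * max (pairing ?d x) (pairing (\<lambda>b. - 1 * ?d b) x)) (k [*] [\<bar>a\<bar>])"
    using max_form_scale[OF max_form_max[OF max_form_pairing[OF d(1)] max_form_pairing[OF d(2)]] assms(2)]
    unfolding d absv_def .
  moreover have "(\<lambda>x. k * max (pairing ?d x) (pairing (\<lambda>b. - 1 * ?d b) x)) = weighted_norm (\<lambda>b. if b = a then k else 0)"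
    (is "?f = ?g")
  proof
    fix x show "?f x = ?g x"
      unfolding pairing_scale pairing_single
      by (rule linorder_le_cases[of 0 "x a"]) simp_all
  qed
  ultimately show ?thesis by metis
qed

text \<open>A finitely supported weight \<open>c\<close> gives the lattice element \<open>\<Sum>a. c a * \<bar>a\<bar>\<close>, whose norm is at most the
  total weight because each \<open>a\<close> lies in the unit ball.\<close>

lemma max_form_weighted_norm:
  assumes "finite S" "S \<subseteq> unit_ball" "\<And>a. 0 \<le> c a"
  shows "\<exists>w. max_form (weighted_norm (\<lambda>a. if a \<in> S then c a else 0)) w \<and> normv X w \<le> sum c S"
  using assms(1,2)
proof (induction S)
  case empty
  then show ?case using max_form_pairing[OF forms_zero] evaluate_zero norm_zero
    by (intro exI[of _ "[0]"]) (simp add: pairing_zero[abs_def])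
next
  case (insert a S)
  then obtain w where w: "max_form (weighted_norm (\<lambda>a. if a \<in> S then c a else 0)) w" "normv X w \<le> sum c S"
    by auto
  let ?v = "c a [*] [\<bar>a\<bar>]"
  have v: "max_form (weighted_norm (\<lambda>b. if b = a then c a else 0)) ?v"
    using max_form_weighted_norm_single insert.prems assms(3) by simp
  have a: "a \<in> C" "normv X a \<le> 1" using insert.prems unit_ball_def by auto
  have "normv X ?v \<le> c a * 1"
    using norm_scale[of "[\<bar>a\<bar>]" "c a"] norm_abs[OF a(1)] abs_closed[OF a(1)] a(2) assms(3)[of a]
    by (simp add: mult_left_le)
  then have "normv X (?v [+] w) \<le> sum c (insert a S)"
    using norm_triangle[of ?v w] w(2) max_form_closed[OF v] max_form_closed[OF w(1)] insert.hyps by simp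
  moreover have "weighted_norm (\<lambda>b. if b \<in> insert a S then c b else 0) =
      (\<lambda>x. weighted_norm (\<lambda>b. if b = a then c a else 0) x + weighted_norm (\<lambda>a. if a \<in> S then c a else 0) x)"
    unfolding pairing_add[symmetric] using insert.hyps by (intro ext arg_cong2[of _ _ _ _ pairing]) auto
  ultimately show ?case using max_form_add[OF v w(1)] by metis
qed

end

section \<open>Functions representing elements of the lattice\<close>

context banach_lattice
begin

text \<open>Differences of maxima of linear forms make up the vector lattice generated by the coordinates
  (on which \<open>max\<close> can be computed by \<open>sup_minus\<close>); \<open>y\<close> is the corresponding element of the given lattice.\<close>

definition lattice_form where
  "lattice_form g y \<longleftrightarrow> (\<exists>p a q b. max_form p a \<and> max_form q b \<and> g = (\<lambda>x. p x - q x) \<and> y = a [-] b)"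

lemma lattice_formI:
  "\<lbrakk>max_form p a; max_form q b; g = (\<lambda>x. p x - q x); y = a [-] b\<rbrakk> \<Longrightarrow> lattice_form g y"
  unfolding lattice_form_def by blast

lemma lattice_formE:
  assumes "lattice_form g y"
  obtains p a q b where "max_form p a" "max_form q b" "g = (\<lambda>x. p x - q x)" "y = a [-] b"
    "a \<in> C" "b \<in> C"
  using assms max_form_closed unfolding lattice_form_def by blast

lemma lattice_form_closed: "lattice_form g y \<Longrightarrow> y \<in> C"
  by (elim lattice_formE) (simp add: minus_closed)

lemma lattice_form_max_form:
  assumes "max_form p a"
  shows "lattice_form p a"
  using lattice_formI[OF assms max_form_pairing[OF forms_zero]]
    minus_zero[OF max_form_closed[OF assms]] by (simp add: pairing_zero evaluate_zero)

lemma lattice_form_add: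
  assumes "lattice_form g y" "lattice_form g' y'"
  shows "lattice_form (\<lambda>x. g x + g' x) (y [+] y')"
proof -
  obtain p a q b where 1: "max_form p a" "max_form q b" "g = (\<lambda>x. p x - q x)" "y = a [-] b"
    "a \<in> C" "b \<in> C" using assms(1) by (rule lattice_formE)
  obtain p' a' q' b' where 2: "max_form p' a'" "max_form q' b'" "g' = (\<lambda>x. p' x - q' x)"
    "y' = a' [-] b'" "a' \<in> C" "b' \<in> C" using assms(2) by (rule lattice_formE)
  show ?thesis
    by (rule lattice_formI[OF max_form_add[OF 1(1) 2(1)] max_form_add[OF 1(2) 2(2)]])
       (use 1 2 minus_add_minus in auto)
qed

lemma lattice_form_scale:
  assumes "lattice_form g y"
  shows "lattice_form (\<lambda>x. r * g x) (r [*] y)"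
proof -
  obtain p a q b where 1: "max_form p a" "max_form q b" "g = (\<lambda>x. p x - q x)" "y = a [-] b"
    "a \<in> C" "b \<in> C" using assms(1) by (rule lattice_formE)
  show ?thesis
  proof (cases "0 \<le> r")
    case True
    then show ?thesis
      by (intro lattice_formI[OF max_form_scale[OF 1(1), of r] max_form_scale[OF 1(2), of r]])
         (use 1 scale_minus_right in \<open>auto simp: right_diff_distrib\<close>)
  next
    case False
    have "r [*] y = (- r) [*] b [-] (- r) [*] a"
      using 1 neg_minus[of a b] scale_minus_right[of b a "- r"] scale_scale[of "a [-] b" "- r" "- 1"] closed
      by simp
    then show ?thesis using False
      by (intro lattice_formI[OF max_form_scale[OF 1(2), of "- r"] max_form_scale[OF 1(1), of "- r"]])
         (use 1 in \<open>auto simp: right_diff_distrib\<close>)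
  qed
qed

lemma lattice_form_max:
  assumes "lattice_form g y" "lattice_form g' y'"
  shows "lattice_form (\<lambda>x. max (g x) (g' x)) (y [\<squnion>] y')"
proof -
  obtain p a q b where 1: "max_form p a" "max_form q b" "g = (\<lambda>x. p x - q x)" "y = a [-] b"
    "a \<in> C" "b \<in> C" using assms(1) by (rule lattice_formE)
  obtain p' a' q' b' where 2: "max_form p' a'" "max_form q' b'" "g' = (\<lambda>x. p' x - q' x)"
    "y' = a' [-] b'" "a' \<in> C" "b' \<in> C" using assms(2) by (rule lattice_formE)
  show ?thesis
    by (rule lattice_formI[OF max_form_max[OF max_form_add[OF 1(1) 2(2)] max_form_add[OF 2(1) 1(2)]]
            max_form_add[OF 1(2) 2(2)]])
       (use 1 2 sup_minus in \<open>auto simp: max_def\<close>)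
qed

lemma max_form_infinite: "\<lbrakk>max_form p z; infinite {a. x a \<noteq> 0}\<rbrakk> \<Longrightarrow> p x = 0"
  unfolding max_form_def using pairing_infinite by metis

text \<open>A maximum of forms sees only the finitely many coordinates that occur in them.\<close>

lemma max_form_support:
  assumes "max_form p z"
  shows "\<exists>S. finite S \<and> S \<subseteq> unit_ball \<and> (\<forall>T x. S \<subseteq> T \<longrightarrow> finite {a. x a \<noteq> 0} \<longrightarrow>
           p (\<lambda>a. if a \<in> T then x a else 0) = p x)"
proof -
  obtain P where P: "finite P" "P \<subseteq> forms" "\<And>x. \<exists>l\<in>P. p x = pairing l x"
    "\<And>l x. l \<in> P \<Longrightarrow> pairing l x \<le> p x"
    using assms by (elim max_formE) blast
  define S where "S = (\<Union>l\<in>P. {a. l a \<noteq> 0})"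
  have "p (\<lambda>a. if a \<in> T then x a else 0) = p x" if T: "S \<subseteq> T" "finite {a. x a \<noteq> 0}" for T x
  proof -
    have eq: "pairing l (\<lambda>a. if a \<in> T then x a else 0) = pairing l x" if "l \<in> P" for l
      using pairing_restrict[OF T(2), of T l] T(1) that unfolding S_def by blast
    show ?thesis
    proof (rule order_antisym)
      show "p (\<lambda>a. if a \<in> T then x a else 0) \<le> p x"
        using P(3)[of "\<lambda>a. if a \<in> T then x a else 0"] P(4)[of _ x] eq by fastforce
      show "p x \<le> p (\<lambda>a. if a \<in> T then x a else 0)"
        using P(3)[of x] P(4)[of _ "\<lambda>a. if a \<in> T then x a else 0"] eq by fastforce
    qed
  qed
  moreover have "finite S" "S \<subseteq> unit_ball" using P(1,2) unfolding S_def forms_def by auto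
  ultimately show ?thesis by blast
qed

lemma max_form_bounded:
  assumes "max_form p z"
  shows "\<exists>r. \<exists>c\<in>l1_ball unit_ball r. \<forall>x. \<bar>p x\<bar> \<le> weighted_norm c x"
proof -
  obtain P where P: "finite P" "P \<subseteq> forms" "\<And>x. \<exists>l\<in>P. p x = pairing l x"
    using assms by (elim max_formE) blast
  define c where "c = (\<lambda>a. \<Sum>l\<in>P. \<bar>l a\<bar>)"
  define S where "S = (\<Union>l\<in>P. {a. l a \<noteq> 0})"
  have S: "finite S" "S \<subseteq> unit_ball" using P(1,2) unfolding S_def forms_def by auto
  have c: "0 \<le> c a" for a unfolding c_def by (simp add: sum_nonneg)
  have c0: "c a = 0" if "a \<notin> S" for a
    unfolding c_def using that unfolding S_def by (intro sum.neutral) auto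
  have "sum c F \<le> sum c S" if "finite F" for F
  proof -
    have "sum c F = sum c (F \<inter> S)" using that c0 by (intro sum.mono_neutral_right) auto
    also have "\<dots> \<le> sum c S" using S c by (intro sum_mono2) auto
    finally show ?thesis .
  qed
  then have "c \<in> l1_ball unit_ball (sum c S)"
    using c c0 S(2) unfolding l1_ball_def by blast
  moreover have "\<bar>p x\<bar> \<le> weighted_norm c x" for x
  proof -
    obtain l where l: "l \<in> P" "p x = pairing l x" using P(3) by blast
    have "weighted_norm (\<lambda>a. \<bar>l a\<bar>) x \<le> weighted_norm c x"
      unfolding c_def using P(1) l(1) by (intro weighted_norm_mono member_le_sum) auto
    then show ?thesis using abs_pairing_le[of l x] l(2) by simp
  qed
  ultimately show ?thesis by blast
qed

text \<open>The function \<open>g = p - q\<close> depends on finitely many coordinates, so the weight \<open>c\<close> can be cut down to a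
  finite set. Then the bounds \<open>p \<le> q + weighted_norm c\<close> and \<open>q \<le> p + weighted_norm c\<close> are inequalities
  between maxima of forms, which pass to the lattice by \<open>max_form_mono\<close>.\<close>

lemma lattice_form_contractive:
  assumes "lattice_form g y" "c \<in> l1_ball unit_ball r" "\<And>x. \<bar>g x\<bar> \<le> weighted_norm c x"
  shows "normv X y \<le> r"
proof -
  obtain p a q b where 1: "max_form p a" "max_form q b" "g = (\<lambda>x. p x - q x)" "y = a [-] b"
    "a \<in> C" "b \<in> C" using assms(1) by (rule lattice_formE)
  obtain S1 where S1: "finite S1" "S1 \<subseteq> unit_ball"
    "\<And>T x. \<lbrakk>S1 \<subseteq> T; finite {a. x a \<noteq> 0}\<rbrakk> \<Longrightarrow> p (\<lambda>a. if a \<in> T then x a else 0) = p x"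
    using max_form_support[OF 1(1)] by blast
  obtain S2 where S2: "finite S2" "S2 \<subseteq> unit_ball"
    "\<And>T x. \<lbrakk>S2 \<subseteq> T; finite {a. x a \<noteq> 0}\<rbrakk> \<Longrightarrow> q (\<lambda>a. if a \<in> T then x a else 0) = q x"
    using max_form_support[OF 1(2)] by blast
  define S where "S = S1 \<union> S2"
  have S: "finite S" "S \<subseteq> unit_ball" unfolding S_def using S1 S2 by auto
  define c' where "c' = (\<lambda>a. if a \<in> S then c a else 0)"
  obtain w where w: "max_form (weighted_norm c') w" "normv X w \<le> sum c S"
    using max_form_weighted_norm[OF S, of c] l1_ball_nonneg[OF assms(2)] unfolding c'_def by blast
  have le: "\<bar>p x - q x\<bar> \<le> weighted_norm c' x" for x
  proof (cases "finite {a. x a \<noteq> 0}")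
    case True
    let ?x = "\<lambda>a. if a \<in> S then x a else 0"
    have "weighted_norm c ?x = pairing c' (\<lambda>a. if a \<in> S then \<bar>x a\<bar> else 0)"
      unfolding pairing_def c'_def by (rule sum.cong) auto
    also have "\<dots> = weighted_norm c' x"
      using True by (intro pairing_restrict) (auto simp: c'_def)
    finally show ?thesis
      using assms(3)[of ?x] S1(3)[of S x] S2(3)[of S x] True unfolding S_def 1(3) by simp
  next
    case False
    then show ?thesis
      using max_form_infinite[OF 1(1)] max_form_infinite[OF 1(2)] max_form_infinite[OF w(1)] by simp
  qed
  have wC: "w \<in> C" using max_form_closed w(1) by blast
  have "p x \<le> q x + weighted_norm c' x" "q x \<le> p x + weighted_norm c' x" for x using le[of x] by auto
  then have "a [\<le>] b [+] w" "b [\<le>] a [+] w"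
    using max_form_mono[OF 1(1) max_form_add[OF 1(2) w(1)]]
      max_form_mono[OF 1(2) max_form_add[OF 1(1) w(1)]] by auto
  then have "y [\<le>] w" "(- 1) [*] y [\<le>] w"
    using 1(4,5,6) wC minus_le_iff neg_minus by auto
  then have "normv X y \<le> normv X w"
    using 1(4,5,6) wC closed by (intro norm_le_of_abs_le) auto
  also have "\<dots> \<le> sum c S" by (fact w(2))
  also have "\<dots> \<le> r" using assms(2) S(1) unfolding l1_ball_def by blast
  finally show ?thesis .
qed

text \<open>The distance of \<open>f\<close> and \<open>g\<close> in the norm of the free Banach lattice, as a relation: the infimum that
  defines the norm is only taken once the functions of finite norm are known.\<close>

definition near where
  "near e f g \<longleftrightarrow> (\<exists>c\<in>l1_ball unit_ball e. \<forall>x. \<bar>f x - g x\<bar> \<le> weighted_norm c x)"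

lemma near_radius_nonneg: "near e f g \<Longrightarrow> 0 \<le> e"
  unfolding near_def using l1_ball_radius_nonneg by blast

lemma near_refl: "0 \<le> e \<Longrightarrow> near e f f"
  unfolding near_def using zero_in_l1_ball by (intro bexI[of _ "\<lambda>a. 0"]) (auto simp: pairing_zero)

lemma near_commute: "near e f g \<Longrightarrow> near e g f"
  unfolding near_def by (simp add: abs_minus_commute)

lemma near_mono: "\<lbrakk>near e f g; e \<le> e'\<rbrakk> \<Longrightarrow> near e' f g"
  unfolding near_def using l1_ball_mono by blast

lemma near_combine:
  assumes "near e f g" "near e' f' g'" "\<And>x. \<bar>h x - h' x\<bar> \<le> \<bar>f x - g x\<bar> + \<bar>f' x - g' x\<bar>"
  shows "near (e + e') h h'"
proof -
  obtain c where c: "c \<in> l1_ball unit_ball e" "\<And>x. \<bar>f x - g x\<bar> \<le> weighted_norm c x"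
    using assms(1) unfolding near_def by blast
  obtain c' where c': "c' \<in> l1_ball unit_ball e'" "\<And>x. \<bar>f' x - g' x\<bar> \<le> weighted_norm c' x"
    using assms(2) unfolding near_def by blast
  have "\<bar>h x - h' x\<bar> \<le> weighted_norm (\<lambda>a. c a + c' a) x" for x
    unfolding pairing_add using assms(3)[of x] c(2)[of x] c'(2)[of x] by linarith
  then show ?thesis unfolding near_def using l1_ball_add[OF c(1) c'(1)] by blast
qed

lemma near_trans: "\<lbrakk>near e f g; near e' g h\<rbrakk> \<Longrightarrow> near (e + e') f h"
  by (rule near_combine) auto

lemma near_add: "\<lbrakk>near e f g; near e' f' g'\<rbrakk> \<Longrightarrow> near (e + e') (\<lambda>x. f x + f' x) (\<lambda>x. g x + g' x)"
  by (rule near_combine) auto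

lemma near_max:
  "\<lbrakk>near e f g; near e' f' g'\<rbrakk> \<Longrightarrow> near (e + e') (\<lambda>x. max (f x) (f' x)) (\<lambda>x. max (g x) (g' x))"
  by (rule near_combine) auto

lemma near_scale:
  assumes "near e f g"
  shows "near (\<bar>k\<bar> * e) (\<lambda>x. k * f x) (\<lambda>x. k * g x)"
proof -
  obtain c where c: "c \<in> l1_ball unit_ball e" "\<And>x. \<bar>f x - g x\<bar> \<le> weighted_norm c x"
    using assms unfolding near_def by blast
  have "\<bar>k * f x - k * g x\<bar> \<le> weighted_norm (\<lambda>a. \<bar>k\<bar> * c a) x" for x
    using c(2)[of x] unfolding pairing_scale right_diff_distrib[symmetric] abs_mult
    by (intro mult_left_mono) auto
  then show ?thesis unfolding near_def using l1_ball_scale[OF c(1), of "\<bar>k\<bar>"] by auto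
qed

text \<open>The closure of the graph of the homomorphism defined on the generated vector lattice. Its domain is
  the free Banach lattice, so that neither a completion nor an extension by continuity has to be built.\<close>

definition represents where
  "represents f z \<longleftrightarrow>
     z \<in> C \<and> (\<forall>e>0. \<exists>g y. lattice_form g y \<and> near e f g \<and> dist_X z y \<le> e)"

lemma represents_closed: "represents f z \<Longrightarrow> z \<in> C"
  unfolding represents_def by blast

lemma representsE:
  assumes "represents f z" "0 < e"
  obtains g y where "lattice_form g y" "near e f g" "dist_X z y \<le> e" "y \<in> C"
  using assms lattice_form_closed unfolding represents_def by blast

lemma dist_self: "x \<in> C \<Longrightarrow> dist_X x x = 0"
  unfolding dist_X_def by (simp add: minus_self norm_zero)

lemma represents_lattice_form: "lattice_form g y \<Longrightarrow> represents g y"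
  unfolding represents_def using lattice_form_closed near_refl dist_self
  by (intro conjI allI impI exI[of _ g] exI[of _ y]) auto

lemma represents_limit:
  assumes z: "z \<in> C" and lim: "\<And>e. 0 < e \<Longrightarrow> \<exists>f' z'. represents f' z' \<and> near e f f' \<and> dist_X z z' \<le> e"
  shows "represents f z"
  unfolding represents_def
proof (intro conjI allI impI z)
  fix e :: real assume "0 < e"
  then have e: "0 < e / 2" by simp
  obtain f' z' where 1: "represents f' z'" "near (e/2) f f'" "dist_X z z' \<le> e/2" using lim[OF e] by blast
  obtain g y where 2: "lattice_form g y" "near (e/2) f' g" "dist_X z' y \<le> e/2" "y \<in> C"
    using representsE[OF 1(1) e] .
  have "near e f g" using near_trans[OF 1(2) 2(2)] by simp
  moreover have "dist_X z y \<le> e"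
    using dist_triangle[OF z represents_closed[OF 1(1)] 2(4)] 1(3) 2(3) by simp
  ultimately show "\<exists>g y. lattice_form g y \<and> near e f g \<and> dist_X z y \<le> e" using 2(1) by blast
qed

lemma represents_add:
  assumes "represents f z" "represents f' z'"
  shows "represents (\<lambda>x. f x + f' x) (z [+] z')"
proof (rule represents_limit)
  have z: "z \<in> C" "z' \<in> C" using assms represents_closed by auto
  then show "z [+] z' \<in> C" by (rule add_closed)
  fix e :: real assume "0 < e"
  then have e: "0 < e / 2" by simp
  obtain g y where 1: "lattice_form g y" "near (e/2) f g" "dist_X z y \<le> e/2" "y \<in> C"
    using representsE[OF assms(1) e] .
  obtain g' y' where 2: "lattice_form g' y'" "near (e/2) f' g'" "dist_X z' y' \<le> e/2" "y' \<in> C"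
    using representsE[OF assms(2) e] .
  show "\<exists>h v. represents h v \<and> near e (\<lambda>x. f x + f' x) h \<and> dist_X (z [+] z') v \<le> e"
    using represents_lattice_form[OF lattice_form_add[OF 1(1) 2(1)]] near_add[OF 1(2) 2(2)]
      dist_add[OF z(1) z(2) 1(4) 2(4)] 1(3) 2(3)
    by (intro exI[of _ "\<lambda>x. g x + g' x"] exI[of _ "y [+] y'"]) auto
qed

lemma represents_max:
  assumes "represents f z" "represents f' z'"
  shows "represents (\<lambda>x. max (f x) (f' x)) (z [\<squnion>] z')"
proof (rule represents_limit)
  have z: "z \<in> C" "z' \<in> C" using assms represents_closed by auto
  then show "z [\<squnion>] z' \<in> C" by (rule sup_closed)
  fix e :: real assume "0 < e"
  then have e: "0 < e / 2" by simp
  obtain g y where 1: "lattice_form g y" "near (e/2) f g" "dist_X z y \<le> e/2" "y \<in> C"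
    using representsE[OF assms(1) e] .
  obtain g' y' where 2: "lattice_form g' y'" "near (e/2) f' g'" "dist_X z' y' \<le> e/2" "y' \<in> C"
    using representsE[OF assms(2) e] .
  show "\<exists>h v. represents h v \<and> near e (\<lambda>x. max (f x) (f' x)) h \<and> dist_X (z [\<squnion>] z') v \<le> e"
    using represents_lattice_form[OF lattice_form_max[OF 1(1) 2(1)]] near_max[OF 1(2) 2(2)]
      dist_sup[OF z(1) z(2) 1(4) 2(4)] 1(3) 2(3)
    by (intro exI[of _ "\<lambda>x. max (g x) (g' x)"] exI[of _ "y [\<squnion>] y'"]) auto
qed

lemma represents_scale:
  assumes "represents f z"
  shows "represents (\<lambda>x. k * f x) (k [*] z)"
proof (rule represents_limit)
  have z: "z \<in> C" using assms represents_closed by auto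
  then show "k [*] z \<in> C" by (rule scale_closed)
  fix e :: real assume e: "0 < e"
  define d where "d = e / (\<bar>k\<bar> + 1)"
  have d: "0 < d" "\<bar>k\<bar> * d \<le> e" unfolding d_def using e by (auto simp: field_simps)
  obtain g y where 1: "lattice_form g y" "near d f g" "dist_X z y \<le> d" "y \<in> C"
    using representsE[OF assms(1) d(1)] .
  have "\<bar>k\<bar> * dist_X z y \<le> e" using mult_left_mono[OF 1(3), of "\<bar>k\<bar>"] d(2) by simp
  then show "\<exists>h v. represents h v \<and> near e (\<lambda>x. k * f x) h \<and> dist_X (k [*] z) v \<le> e"
    using represents_lattice_form[OF lattice_form_scale[OF 1(1), of k]]
      near_mono[OF near_scale[OF 1(2), of k] d(2)] dist_scale[OF z 1(4), of k]
    by (intro exI[of _ "\<lambda>x. k * g x"] exI[of _ "k [*] y"]) auto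
qed

lemma represents_minus:
  assumes "represents f z" "represents f' z'"
  shows "represents (\<lambda>x. f x - f' x) (z [-] z')"
  using represents_add[OF assms(1) represents_scale[OF assms(2), of "-1"]] by (simp add: minusv_def)

lemma represents_min:
  assumes "represents f z" "represents f' z'"
  shows "represents (\<lambda>x. min (f x) (f' x)) (z [\<sqinter>] z')"
proof -
  have "(\<lambda>x. min (f x) (f' x)) = (\<lambda>x. - 1 * max (- 1 * f x) (- 1 * f' x))" by (auto simp: min_def max_def)
  then show ?thesis
    using represents_scale[OF represents_max[OF represents_scale[OF assms(1), of "-1"]
          represents_scale[OF assms(2), of "-1"]], of "-1"]
      inf_eq_neg_sup[OF represents_closed[OF assms(1)] represents_closed[OF assms(2)]] by simp
qed

lemma represents_abs:
  assumes "represents f z"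
  shows "represents (\<lambda>x. \<bar>f x\<bar>) [\<bar>z\<bar>]"
proof -
  have "(\<lambda>x. \<bar>f x\<bar>) = (\<lambda>x. max (f x) (- 1 * f x))" by auto
  then show ?thesis
    using represents_max[OF assms represents_scale[OF assms, of "-1"]] unfolding absv_def by simp
qed

lemma represents_zero: "represents (\<lambda>x. 0) [0]"
  using represents_lattice_form[OF lattice_form_max_form[OF max_form_pairing[OF forms_zero]]]
  by (simp add: pairing_zero[abs_def] evaluate_zero)

lemma represents_bounded:
  assumes "represents f z"
  shows "\<exists>r. near r f (\<lambda>x. 0)"
proof -
  obtain g y where g: "lattice_form g y" "near 1 f g"
    by (rule representsE[OF assms zero_less_one])
  obtain p a q b where 1: "max_form p a" "max_form q b" "g = (\<lambda>x. p x - q x)"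
    using g(1) by (rule lattice_formE)
  obtain r s where "near r p (\<lambda>x. 0)" "near s q (\<lambda>x. 0)"
    using max_form_bounded[OF 1(1)] max_form_bounded[OF 1(2)] unfolding near_def by auto
  then have "near (r + s) g (\<lambda>x. 0)" unfolding 1(3) by (rule near_combine) auto
  then show ?thesis using near_trans[OF g(2)] by blast
qed

text \<open>Contractivity survives the closure; it also makes \<open>represents\<close> single-valued.\<close>

lemma represents_norm_le:
  assumes "represents f z" "near r f (\<lambda>x. 0)"
  shows "normv X z \<le> r"
proof (rule field_le_epsilon)
  fix e :: real assume "0 < e"
  then have e: "0 < e / 2" by simp
  obtain g y where 1: "lattice_form g y" "near (e/2) f g" "dist_X z y \<le> e/2" "y \<in> C"
    using representsE[OF assms(1) e] .
  have "near (e/2 + r) g (\<lambda>x. 0)" using near_trans[OF near_commute[OF 1(2)] assms(2)] .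
  then have "normv X y \<le> e/2 + r"
    unfolding near_def using lattice_form_contractive[OF 1(1)] by auto
  then show "normv X z \<le> r + e"
    using norm_le_dist[OF represents_closed[OF assms(1)] 1(4)] 1(3) by simp
qed

lemma represents_unique:
  assumes "represents f z" "represents f z'"
  shows "z = z'"
proof -
  have z: "z \<in> C" "z' \<in> C" using assms represents_closed by auto
  have "normv X (z [-] z') \<le> 0"
    using represents_norm_le[OF represents_minus[OF assms]] near_refl[of 0] by simp
  then have "normv X (z [-] z') = 0" using norm_nonneg[of "z [-] z'"] z closed by simp
  then show ?thesis using norm_eq_zero[of "z [-] z'"] minus_eq_zero[OF z] z closed by simp
qed

lemma represents_mono:
  assumes "represents f z" "represents g y" "\<And>x. f x \<le> g x"
  shows "z [\<le>] y"
proof -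
  have "(\<lambda>x. max (f x) (g x)) = g" using assms(3) by (auto simp: max_absorb2)
  then have "represents g (z [\<squnion>] y)" using represents_max[OF assms(1,2)] by simp
  then have "z [\<squnion>] y = y" using represents_unique assms(2) by blast
  then show ?thesis
    using sup_ge1[OF represents_closed[OF assms(1)] represents_closed[OF assms(2)]] by simp
qed

text \<open>The coordinate of the normalized \<open>z\<close>, scaled by the norm of \<open>z\<close>, represents \<open>z\<close> without increasing its
  norm; this makes the quotient map isometric rather than merely bounded.\<close>

lemma represents_surj:
  assumes "z \<in> C"
  shows "\<exists>f. represents f z \<and> near (normv X z) f (\<lambda>x. 0)"
proof (cases "z = [0]")
  case True
  then show ?thesis using represents_zero near_refl norm_zero by auto
next
  case False
  define n where "n = normv X z"
  have n: "0 < n" using norm_nonneg[OF assms] norm_eq_zero[OF assms] False unfolding n_def by simp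
  define u where "u = (1/n) [*] z"
  have u: "u \<in> unit_ball" "n [*] u = z"
    unfolding unit_ball_def u_def using n assms norm_scale scale_closed
    by (auto simp: n_def[symmetric] scale_scale scale_one)
  let ?l = "\<lambda>b. n * (if b = u then 1 else 0)"
  have l: "?l \<in> forms" "evaluate ?l = z"
    using forms_scale evaluate_scale forms_single[OF u(1)] evaluate_single[OF u(1)] u(2) by auto
  have "represents (pairing ?l) z"
    using represents_lattice_form[OF lattice_form_max_form[OF max_form_pairing[OF l(1)]]] l(2) by simp
  moreover have "near n (pairing ?l) (\<lambda>x. 0)"
  proof -
    have "sum (\<lambda>b. if b = u then 1 else (0::real)) F \<le> 1" if "finite F" for F
      using that by (simp add: sum.delta)
    then have "(\<lambda>b. if b = u then 1 else 0) \<in> l1_ball unit_ball 1"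
      unfolding l1_ball_def using u(1) by auto
    then have "?l \<in> l1_ball unit_ball n" using l1_ball_scale[of _ _ 1 n] n by fastforce
    moreover have "(\<lambda>b. \<bar>?l b\<bar>) = ?l" using n by auto
    ultimately show ?thesis
      unfolding near_def using abs_pairing_le[of ?l] by (intro bexI[of _ ?l]) auto
  qed
  ultimately show ?thesis unfolding n_def by blast
qed

end

section \<open>The free Banach lattice over the unit ball\<close>

context banach_lattice
begin

lemma near_pointwise: "near e f g \<Longrightarrow> \<bar>f x - g x\<bar> \<le> e * (\<Sum>a | x a \<noteq> 0. \<bar>x a\<bar>)"
  unfolding near_def using weighted_norm_le_of_l1_ball order_trans by blast

lemma near_diff_iff: "near e (\<lambda>x. f x - g x) (\<lambda>x. 0) \<longleftrightarrow> near e f g"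
  unfolding near_def by simp

lemma represents_dist_le:
  assumes "represents f z" "represents g y" "near e f g"
  shows "dist_X z y \<le> e"
  unfolding dist_X_def
  using represents_norm_le[OF represents_minus[OF assms(1,2)]] assms(3) near_diff_iff by blast

text \<open>The elements represented by a sequence that converges form a Cauchy sequence by contractivity.\<close>

lemma represents_sequence_limit:
  assumes f: "\<And>n. represents (f n) (z n)"
    and lim: "\<And>e. 0 < e \<Longrightarrow> \<exists>N::nat. \<forall>n\<ge>N. near e (f n) g"
  shows "\<exists>l. represents g l"
proof -
  have zC: "z n \<in> C" for n using represents_closed f by blast
  have "cauchy_normv X z"
    unfolding cauchy_normv_def
  proof (intro allI impI)
    fix e :: real assume e: "0 < e"
    obtain N where N: "\<And>n. n \<ge> N \<Longrightarrow> near (e/3) (f n) g" using lim[of "e/3"] e by auto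
    have "normv X (z m [-] z n) < e" if "m \<ge> N" "n \<ge> N" for m n
      using represents_dist_le[OF f f near_trans[OF N[OF that(1)] near_commute[OF N[OF that(2)]]]] e
      unfolding dist_X_def by simp
    then show "\<exists>N. \<forall>m\<ge>N. \<forall>n\<ge>N. normv X (z m [-] z n) < e" by blast
  qed
  then obtain l where l: "l \<in> C" "tendsto_normv X z l" using complete[of z] zC by blast
  have "represents g l"
  proof (rule represents_limit[OF l(1)])
    fix e :: real assume e: "0 < e"
    obtain N where N: "\<And>n. n \<ge> N \<Longrightarrow> near e (f n) g" using lim[OF e] by auto
    have "\<forall>\<^sub>F n in sequentially. dist_X (z n) l < e"
      using order_tendstoD(2)[OF l(2)[unfolded tendsto_normv_def] e] unfolding dist_X_def .
    then obtain M where M: "\<And>n. n \<ge> M \<Longrightarrow> dist_X (z n) l < e"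
      unfolding eventually_sequentially by blast
    have "dist_X l (z (max M N)) \<le> e"
      using M[of "max M N"] dist_commute[OF l(1) zC] by simp
    then show "\<exists>f' z'. represents f' z' \<and> near e g f' \<and> dist_X l z' \<le> e"
      using f near_commute[OF N[of "max M N"]] by auto
  qed
  then show ?thesis by blast
qed

text \<open>Majorants belong to the free Banach lattice: the total weight of \<open>c\<close> is approached on finite sets
  \<open>F n\<close>, and \<open>c\<close> restricted to these gives maxima of forms converging to \<open>weighted_norm c\<close>.\<close>

lemma represents_weighted_norm:
  assumes c: "c \<in> l1_ball unit_ball r"
  shows "\<exists>b. represents (weighted_norm c) b"
proof -
  define s where "s = (SUP F\<in>{F. finite F}. sum c F)"
  have bdd: "bdd_above (sum c ` {F. finite F})"
    using c unfolding l1_ball_def by (intro bdd_aboveI2[of _ _ r]) auto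
  have "\<exists>F. finite F \<and> s - 1 / real (Suc n) < sum c F" for n
  proof -
    have "s - 1 / real (Suc n) < s" by simp
    then show ?thesis
      unfolding s_def using less_cSUP_iff[OF _ bdd] by blast
  qed
  then obtain F where F: "\<And>n. finite (F n)" "\<And>n. s - 1 / real (Suc n) < sum c (F n)"
    by metis
  have c0: "0 \<le> c a" "a \<notin> unit_ball \<Longrightarrow> c a = 0" for a using c unfolding l1_ball_def by auto
  define d where "d = (\<lambda>n a. if a \<in> F n \<inter> unit_ball then c a else 0)"
  have "\<exists>w. represents (weighted_norm (d n)) w" for n
    using max_form_weighted_norm[of "F n \<inter> unit_ball" c] F(1) c0(1)
      represents_lattice_form lattice_form_max_form unfolding d_def by blast
  then obtain w where w: "\<And>n. represents (weighted_norm (d n)) (w n)" by metis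
  have near: "near (1 / real (Suc n)) (weighted_norm (d n)) (weighted_norm c)" for n
  proof -
    define h where "h = (\<lambda>a. if a \<in> F n then 0 else c a)"
    have "c a = d n a + h a" for a unfolding d_def h_def using c0 by auto
    then have "weighted_norm c x = weighted_norm (d n) x + weighted_norm h x" for x
      unfolding pairing_add[symmetric] by presburger
    moreover have h0: "0 \<le> h a" for a unfolding h_def using c0 by simp
    moreover have "h \<in> l1_ball unit_ball (1 / real (Suc n))"
      unfolding l1_ball_def
    proof (intro CollectI conjI allI impI)
      fix G :: "'a set" assume G: "finite G"
      have "sum h G = sum c (G - F n)"
        unfolding h_def using G by (intro sum.mono_neutral_cong_right) auto
      also have "\<dots> = sum c (G \<union> F n) - sum c (F n)"
        using G F(1)[of n] sum.union_disjoint[of "G - F n" "F n" c] by (simp add: Un_Diff_cancel2 Diff_Int_distrib2)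
      also have "\<dots> \<le> s - sum c (F n)"
        unfolding s_def using G F(1) by (intro diff_right_mono cSUP_upper[OF _ bdd]) auto
      also have "\<dots> \<le> 1 / real (Suc n)" using F(2)[of n] by linarith
      finally show "sum h G \<le> 1 / real (Suc n)" .
    qed (use h0 c0 h_def in auto)
    ultimately show ?thesis
      unfolding near_def using weighted_norm_nonneg[of h] by (intro bexI[of _ h]) auto
  qed
  show ?thesis
  proof (rule represents_sequence_limit[OF w])
    fix e :: real assume "0 < e"
    then obtain N where N: "1 / real (Suc N) < e" using nat_approx_posE by blast
    have "near e (weighted_norm (d n)) (weighted_norm c)" if "n \<ge> N" for n
    proof (rule near_mono[OF near])
      have "1 / real (Suc n) \<le> 1 / real (Suc N)" using that by (simp add: frac_le)
      then show "1 / real (Suc n) \<le> e" using N by simp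
    qed
    then show "\<exists>N. \<forall>n\<ge>N. near e (weighted_norm (d n)) (weighted_norm c)" by blast
  qed
qed

definition cover_norm where "cover_norm f = Inf {r. near r f (\<lambda>x. 0)}"

text \<open>The free Banach lattice over the unit ball.\<close>

definition cover :: "(('a \<Rightarrow> real) \<Rightarrow> real) normed_lattice" where
  "cover = \<lparr>carrierv = {f. \<exists>z. represents f z}, addv = (\<lambda>f g x. f x + g x), zerov = (\<lambda>x. 0),
     scalev = (\<lambda>r f x. r * f x), lev = (\<lambda>f g. \<forall>x. f x \<le> g x), normv = cover_norm\<rparr>"

lemma cover_simps:
  "carrierv cover = {f. \<exists>z. represents f z}" "addv cover f g = (\<lambda>x. f x + g x)"
  "zerov cover = (\<lambda>x. 0)" "scalev cover r f = (\<lambda>x. r * f x)"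
  "lev cover f g \<longleftrightarrow> (\<forall>x. f x \<le> g x)" "normv cover = cover_norm"
  "minusv cover f g = (\<lambda>x. f x - g x)"
  by (simp_all add: cover_def minusv_def)

lemma cover_norm_le: "near r f (\<lambda>x. 0) \<Longrightarrow> cover_norm f \<le> r"
  unfolding cover_norm_def by (rule cInf_lower) (auto intro: bdd_belowI near_radius_nonneg)

lemma near_if_cover_norm_less:
  assumes "represents f z" "cover_norm f < r"
  shows "near r f (\<lambda>x. 0)"
proof -
  have "{r. near r f (\<lambda>x. 0)} \<noteq> {}" using represents_bounded[OF assms(1)] by blast
  from cInf_lessD[OF this assms(2)[unfolded cover_norm_def]]
  obtain s where s: "near s f (\<lambda>x. 0)" "s < r" by blast
  show ?thesis using near_mono[OF s(1) less_imp_le[OF s(2)]] .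
qed

lemma cover_norm_nonneg:
  assumes "represents f z"
  shows "0 \<le> cover_norm f"
  unfolding cover_norm_def using represents_bounded[OF assms] near_radius_nonneg
  by (intro cInf_greatest) auto

lemma norm_le_cover_norm:
  assumes "represents f z"
  shows "normv X z \<le> cover_norm f"
  by (rule dense_ge) (use represents_norm_le near_if_cover_norm_less assms in blast)

lemma is_supv_cover:
  assumes "f \<in> carrierv cover" "g \<in> carrierv cover"
  shows "is_supv cover f g (\<lambda>x. max (f x) (g x))"
  using assms represents_max unfolding is_supv_def cover_simps by fastforce

lemma is_infv_cover:
  assumes "f \<in> carrierv cover" "g \<in> carrierv cover"
  shows "is_infv cover f g (\<lambda>x. min (f x) (g x))"
  using assms represents_min unfolding is_infv_def cover_simps by fastforce

lemma vector_lattice_cover: "vector_lattice cover"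
proof
  fix f g h :: "('a \<Rightarrow> real) \<Rightarrow> real" and r s :: real
  assume f: "f \<in> carrierv cover"
  show "scalev cover r f \<in> carrierv cover"
    using f represents_scale unfolding cover_simps by blast
  have "scalev cover (- 1) f \<in> carrierv cover"
    using f represents_scale unfolding cover_simps by blast
  then show "\<exists>g\<in>carrierv cover. addv cover f g = zerov cover"
    by (rule bexI[rotated]) (simp add: cover_simps)
  assume g: "g \<in> carrierv cover"
  show "addv cover f g \<in> carrierv cover"
    using f g represents_add unfolding cover_simps by blast
  show "\<exists>s. is_supv cover f g s" "\<exists>s. is_infv cover f g s"
    using is_supv_cover is_infv_cover f g by blast+
  assume "lev cover f g" "lev cover g h"
  then show "lev cover f h" unfolding cover_simps using order_trans by blast
qed (use represents_zero in \<open>auto simp: cover_simps algebra_simps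
    intro: order_antisym mult_left_mono\<close>)

lemma supv_cover:
  "\<lbrakk>f \<in> carrierv cover; g \<in> carrierv cover\<rbrakk> \<Longrightarrow> supv cover f g = (\<lambda>x. max (f x) (g x))"
  using vector_lattice.supv_eqI[OF vector_lattice_cover is_supv_cover] .

lemma absv_cover:
  assumes "f \<in> carrierv cover"
  shows "absv cover f = (\<lambda>x. \<bar>f x\<bar>)"
proof -
  have "absv cover f = (\<lambda>x. max (f x) (scalev cover (- 1) f x))"
    unfolding absv_def
    using supv_cover[OF assms vector_lattice.scale_closed[OF vector_lattice_cover assms]] .
  then show ?thesis by (auto simp: cover_simps)
qed

lemma cover_norm_eq_zero:
  assumes "represents f z"
  shows "cover_norm f = 0 \<longleftrightarrow> f = (\<lambda>x. 0)"
proof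
  assume 0: "cover_norm f = 0"
  show "f = (\<lambda>x. 0)"
  proof
    fix x :: "'a \<Rightarrow> real"
    define K where "K = (\<Sum>a | x a \<noteq> 0. \<bar>x a\<bar>)"
    have K: "0 \<le> K" unfolding K_def by (simp add: sum_nonneg)
    have "\<bar>f x\<bar> \<le> 0 + e" if e: "0 < e" for e
    proof -
      have "near (e / (K + 1)) f (\<lambda>x. 0)"
        using near_if_cover_norm_less[OF assms] 0 e K by simp
      then have "\<bar>f x - 0\<bar> \<le> e / (K + 1) * K" unfolding K_def by (rule near_pointwise)
      also have "\<dots> = e * (K / (K + 1))" by simp
      also have "\<dots> \<le> e * 1" using e K by (intro mult_left_mono) auto
      finally show ?thesis by simp
    qed
    then show "f x = 0" using field_le_epsilon[of "\<bar>f x\<bar>" 0] by simp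
  qed
next
  assume "f = (\<lambda>x. 0)"
  then show "cover_norm f = 0"
    using cover_norm_le[OF near_refl[of 0 "\<lambda>x. 0"]] cover_norm_nonneg[OF assms] by simp
qed

lemma cover_norm_scale_le:
  assumes "represents f z"
  shows "cover_norm (\<lambda>x. k * f x) \<le> \<bar>k\<bar> * cover_norm f"
proof (cases "k = 0")
  case True
  then show ?thesis using cover_norm_eq_zero[OF represents_zero] by simp
next
  case False
  have "cover_norm (\<lambda>x. k * f x) / \<bar>k\<bar> \<le> cover_norm f"
  proof (rule dense_ge)
    fix r assume "cover_norm f < r"
    then have "near r f (\<lambda>x. 0)" using near_if_cover_norm_less assms by blast
    from near_scale[OF this, of k] have "cover_norm (\<lambda>x. k * f x) \<le> \<bar>k\<bar> * r"
      using cover_norm_le by simp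
    then show "cover_norm (\<lambda>x. k * f x) / \<bar>k\<bar> \<le> r" using False by (simp add: field_simps)
  qed
  then show ?thesis using False by (simp add: field_simps)
qed

lemma cover_norm_triangle:
  assumes "represents f z" "represents g y"
  shows "cover_norm (\<lambda>x. f x + g x) \<le> cover_norm f + cover_norm g"
proof (rule field_le_epsilon)
  fix e :: real assume e: "0 < e"
  have "near (cover_norm f + e/2) f (\<lambda>x. 0)" "near (cover_norm g + e/2) g (\<lambda>x. 0)"
    using near_if_cover_norm_less assms e by auto
  from near_add[OF this] show "cover_norm (\<lambda>x. f x + g x) \<le> cover_norm f + cover_norm g + e"
    using cover_norm_le by fastforce
qed

text \<open>The majorants of \<open>h - f m\<close> change with \<open>m\<close>. By compactness it suffices to find one for finitely many points
  \<open>x\<close> and bounds \<open>t < \<bar>h x - g x\<bar>\<close> at a time, and for these the majorant at a single large \<open>m\<close> serves.\<close>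

lemma near_limit:
  assumes near: "\<And>m. m \<ge> N \<Longrightarrow> near e h (f m)" and lim: "\<And>x. (\<lambda>m. f m x) \<longlonglongrightarrow> g x"
  shows "near e h g"
proof -
  define K where "K = {(x, t). t < \<bar>h x - g x\<bar>}"
  have "\<exists>c\<in>l1_ball unit_ball e. \<forall>(x, t)\<in>K. t \<le> weighted_norm c x"
  proof (rule weighted_norm_compactness)
    fix E assume E: "finite E" "E \<subseteq> K"
    have "\<forall>\<^sub>F m in sequentially. snd k < \<bar>h (fst k) - f m (fst k)\<bar>" if "k \<in> E" for k
    proof -
      have "(\<lambda>m. \<bar>h (fst k) - f m (fst k)\<bar>) \<longlonglongrightarrow> \<bar>h (fst k) - g (fst k)\<bar>"
        by (intro tendsto_intros lim)
      moreover have "snd k < \<bar>h (fst k) - g (fst k)\<bar>" using that E(2) unfolding K_def by auto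
      ultimately show ?thesis by (rule order_tendstoD(1))
    qed
    then have "\<forall>\<^sub>F m in sequentially. \<forall>k\<in>E. snd k < \<bar>h (fst k) - f m (fst k)\<bar>"
      using E(1) by (simp add: eventually_ball_finite)
    then have "\<forall>\<^sub>F m in sequentially. m \<ge> N \<and> (\<forall>k\<in>E. snd k < \<bar>h (fst k) - f m (fst k)\<bar>)"
      using eventually_ge_at_top[of N] by eventually_elim auto
    then obtain m where m: "m \<ge> N" "\<forall>k\<in>E. snd k < \<bar>h (fst k) - f m (fst k)\<bar>"
      using eventually_happens'[OF sequentially_bot] by blast
    obtain c where c: "c \<in> l1_ball unit_ball e" "\<And>x. \<bar>h x - f m x\<bar> \<le> weighted_norm c x"
      using near[OF m(1)] unfolding near_def by blast
    have "\<forall>(x, t)\<in>E. t \<le> weighted_norm c x"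
    proof clarify
      fix x t assume "(x, t) \<in> E"
      then have "t < \<bar>h x - f m x\<bar>" using m(2) by force
      then show "t \<le> weighted_norm c x" using c(2)[of x] by simp
    qed
    then show "\<exists>c\<in>l1_ball unit_ball e. \<forall>(x, t)\<in>E. t \<le> weighted_norm c x" using c(1) by blast
  qed
  then obtain c where c: "c \<in> l1_ball unit_ball e" "\<And>x t. t < \<bar>h x - g x\<bar> \<Longrightarrow> t \<le> weighted_norm c x"
    unfolding K_def by blast
  have "\<bar>h x - g x\<bar> \<le> weighted_norm c x" for x by (rule dense_le) (rule c(2))
  then show ?thesis unfolding near_def using c(1) by blast
qed

lemma cover_complete:
  assumes "range f \<subseteq> carrierv cover" "cauchy_normv cover f"
  shows "\<exists>l\<in>carrierv cover. tendsto_normv cover f l"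
proof -
  have "\<forall>n. \<exists>z. represents (f n) z" using assms(1) unfolding cover_simps by blast
  then obtain z where z: "\<And>n. represents (f n) (z n)" by metis
  have cauchy: "\<exists>N. \<forall>m\<ge>N. \<forall>n\<ge>N. near e (f m) (f n)" if "0 < e" for e
  proof -
    have "\<exists>N. \<forall>m\<ge>N. \<forall>n\<ge>N. cover_norm (\<lambda>x. f m x - f n x) < e"
      using assms(2) that unfolding cauchy_normv_def cover_simps by simp
    then obtain N where "\<forall>m\<ge>N. \<forall>n\<ge>N. cover_norm (\<lambda>x. f m x - f n x) < e" ..
    note N = this[rule_format]
    have "near e (f m) (f n)" if "m \<ge> N" "n \<ge> N" for m n
      using near_if_cover_norm_less[OF represents_minus[OF z z] N[OF that]] near_diff_iff by blast
    then show ?thesis by blast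
  qed
  have "convergent (\<lambda>n. f n x)" for x
  proof (rule Cauchy_convergent, rule CauchyI)
    fix e :: real assume e: "0 < e"
    define K where "K = (\<Sum>a | x a \<noteq> 0. \<bar>x a\<bar>)"
    have K: "0 \<le> K" unfolding K_def by (simp add: sum_nonneg)
    obtain N where N: "\<And>m n. \<lbrakk>m \<ge> N; n \<ge> N\<rbrakk> \<Longrightarrow> near (e / (K + 1)) (f m) (f n)"
      using cauchy[of "e / (K + 1)"] e K by auto
    have "norm (f m x - f n x) < e" if "m \<ge> N" "n \<ge> N" for m n
    proof -
      have "\<bar>f m x - f n x\<bar> \<le> e / (K + 1) * K"
        unfolding K_def by (rule near_pointwise[OF N[OF that, unfolded K_def]])
      also have "\<dots> < e" using e K by (simp add: field_simps)
      finally show ?thesis by simp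
    qed
    then show "\<exists>M. \<forall>m\<ge>M. \<forall>n\<ge>M. norm (f m x - f n x) < e" by blast
  qed
  then obtain g where g: "\<And>x. (\<lambda>n. f n x) \<longlonglongrightarrow> g x" unfolding convergent_def by metis
  have lim: "\<exists>N. \<forall>n\<ge>N. near e (f n) g" if "0 < e" for e
  proof -
    obtain N where N: "\<And>m n. \<lbrakk>m \<ge> N; n \<ge> N\<rbrakk> \<Longrightarrow> near e (f m) (f n)" using cauchy[OF \<open>0 < e\<close>] by blast
    have "near e (f n) g" if n: "n \<ge> N" for n by (rule near_limit[OF N[OF n] g])
    then show ?thesis by blast
  qed
  then obtain l where l: "represents g l" using represents_sequence_limit[of f z, OF z lim] by blast
  have "tendsto_normv cover f g"
    unfolding tendsto_normv_def cover_simps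
  proof (rule LIMSEQ_I)
    fix e :: real assume e: "0 < e"
    obtain N where N: "\<And>n. n \<ge> N \<Longrightarrow> near (e/2) (f n) g" using lim[of "e/2"] e by auto
    have "norm (cover_norm (\<lambda>x. f n x - g x) - 0) < e" if "n \<ge> N" for n
      using cover_norm_le[of "e/2" "\<lambda>x. f n x - g x"] N[OF that] near_diff_iff[of _ "f n" g] e
        cover_norm_nonneg[OF represents_minus[OF z l], of n] by simp
    then show "\<exists>N. \<forall>n\<ge>N. norm (cover_norm (\<lambda>x. f n x - g x) - 0) < e" by blast
  qed
  then show ?thesis using l unfolding cover_simps by blast
qed

lemma banach_lattice_cover: "banach_lattice cover"
proof (intro banach_lattice.intro vector_lattice_cover banach_lattice_axioms.intro)
  fix f g :: "('a \<Rightarrow> real) \<Rightarrow> real" and r :: real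
  assume f: "f \<in> carrierv cover"
  then obtain z where z: "represents f z" unfolding cover_simps by blast
  show "normv cover f = 0 \<longleftrightarrow> f = zerov cover"
    using cover_norm_eq_zero[OF z] unfolding cover_simps .
  show "normv cover (scalev cover r f) = \<bar>r\<bar> * normv cover f"
  proof (rule order_antisym)
    show "normv cover (scalev cover r f) \<le> \<bar>r\<bar> * normv cover f"
      unfolding cover_simps by (rule cover_norm_scale_le[OF z])
    show "\<bar>r\<bar> * normv cover f \<le> normv cover (scalev cover r f)"
    proof (cases "r = 0")
      case True
      then show ?thesis
        using cover_norm_nonneg[OF represents_zero] unfolding cover_simps by simp
    next
      case False
      have "(\<lambda>x. (1/r) * (r * f x)) = f" using False by auto
      then have "cover_norm f \<le> \<bar>1/r\<bar> * cover_norm (\<lambda>x. r * f x)"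
        using cover_norm_scale_le[OF represents_scale[OF z, of r], of "1/r"] by simp
      then show ?thesis using False unfolding cover_simps by (simp add: field_simps)
    qed
  qed
  assume g: "g \<in> carrierv cover"
  then obtain y where y: "represents g y" unfolding cover_simps by blast
  show "normv cover (addv cover f g) \<le> normv cover f + normv cover g"
    using cover_norm_triangle[OF z y] unfolding cover_simps .
  assume "lev cover (absv cover f) (absv cover g)"
  then have le: "\<bar>f x\<bar> \<le> \<bar>g x\<bar>" for x
    unfolding absv_cover[OF f] absv_cover[OF g] cover_simps by blast
  show "normv cover f \<le> normv cover g"
    unfolding cover_simps
  proof (rule dense_ge)
    fix r assume "cover_norm g < r"
    then have "near r g (\<lambda>x. 0)" using near_if_cover_norm_less y by blast
    then obtain c where "c \<in> l1_ball unit_ball r" "\<And>x. \<bar>g x\<bar> \<le> weighted_norm c x"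
      unfolding near_def by auto
    then have "near r f (\<lambda>x. 0)"
      unfolding near_def using order_trans[OF le] by (intro bexI[of _ c]) auto
    then show "cover_norm f \<le> r" by (rule cover_norm_le)
  qed
qed (rule cover_complete)

end

section \<open>The lattice as a quotient of the free Banach lattice\<close>

context banach_lattice
begin

definition fibre :: "'a \<Rightarrow> (('a \<Rightarrow> real) \<Rightarrow> real) set" where
  "fibre z = {f. represents f z}"

abbreviation cover_kernel where "cover_kernel \<equiv> fibre [0]"

lemma closed_ideal_kernel: "closed_ideal cover cover_kernel"
  unfolding closed_ideal_def
proof (intro conjI allI ballI impI)
  show "cover_kernel \<subseteq> carrierv cover" unfolding fibre_def cover_simps by blast
  show "zerov cover \<in> cover_kernel" unfolding fibre_def cover_simps using represents_zero by blast
  fix f assume f: "f \<in> cover_kernel"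
  show "scalev cover r f \<in> cover_kernel" for r
    using represents_scale[of f "[0]" r] scale_zero f unfolding fibre_def cover_simps by simp
  show "addv cover f g \<in> cover_kernel" if "g \<in> cover_kernel" for g
    using represents_add[of f "[0]" g "[0]"] add_zero[OF zero_closed] f that
    unfolding fibre_def cover_simps by simp
next
  fix f g
  assume f: "f \<in> carrierv cover" and g: "g \<in> cover_kernel"
    and le: "lev cover (absv cover f) (absv cover g)"
  have g0: "represents g [0]" using g unfolding fibre_def by blast
  then have "g \<in> carrierv cover" unfolding cover_simps by blast
  then have abs: "\<bar>f x\<bar> \<le> \<bar>g x\<bar>" for x using le absv_cover f unfolding cover_simps by metis
  obtain z where z: "represents f z" using f unfolding cover_simps by blast
  have zC: "z \<in> C" using represents_closed[OF z] .
  have zero: "[\<bar>[0]\<bar>] = [0]" using abs_of_nonneg[OF zero_closed le_refl[OF zero_closed]] .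
  have "[\<bar>z\<bar>] [\<le>] [0]"
    using represents_mono[OF represents_abs[OF z] represents_abs[OF g0] abs] unfolding zero .
  then have "[\<bar>z\<bar>] = [0]"
    using le_antisym[OF abs_closed[OF zC] zero_closed] abs_nonneg[OF zC] by blast
  then have "z = [0]" using norm_abs[OF zC] norm_zero norm_eq_zero[OF zC] by simp
  then show "f \<in> cover_kernel" using z unfolding fibre_def by blast
next
  fix f l
  assume "range f \<subseteq> cover_kernel \<and> l \<in> carrierv cover \<and> tendsto_normv cover f l"
  then have f: "\<And>n. represents (f n) [0]" and l: "l \<in> carrierv cover"
    and lim: "(\<lambda>n. cover_norm (\<lambda>x. f n x - l x)) \<longlonglongrightarrow> 0"
    unfolding fibre_def tendsto_normv_def cover_simps by auto
  obtain z where z: "represents l z" using l unfolding cover_simps by blast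
  have zC: "z \<in> C" using represents_closed[OF z] .
  have "normv X ([0] [-] z) \<le> cover_norm (\<lambda>x. f n x - l x)" for n
    using norm_le_cover_norm[OF represents_minus[OF f z]] .
  then have "normv X ([0] [-] z) \<le> 0" using LIMSEQ_le_const[OF lim] by blast
  then have "[0] [-] z = [0]"
    using norm_nonneg[of "[0] [-] z"] norm_eq_zero[of "[0] [-] z"] closed zC by simp
  then have "z = [0]" using minus_eq_zero[OF zero_closed zC] by simp
  then show "l \<in> cover_kernel" using z unfolding fibre_def by blast
qed

abbreviation quotient where "quotient \<equiv> quotient_lattice cover cover_kernel"

lemma quotient_map_eq_fibre:
  assumes "represents f z"
  shows "quotient_map cover cover_kernel f = fibre z"
proof -
  have zC: "z \<in> C" using represents_closed assms by blast
  have "g \<in> quotient_map cover cover_kernel f" if "represents g z" for g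
  proof -
    have "(\<lambda>x. g x - f x) \<in> cover_kernel"
      using represents_minus[OF that assms] minus_self[OF zC] unfolding fibre_def by simp
    moreover have "g = addv cover f (\<lambda>x. g x - f x)" unfolding cover_simps by simp
    ultimately show ?thesis unfolding quotient_map_def by blast
  qed
  moreover have "represents g z" if "g \<in> quotient_map cover cover_kernel f" for g
    using that represents_add[OF assms, of _ "[0]"] add_zero[OF zC]
    unfolding quotient_map_def fibre_def cover_simps by auto
  ultimately show ?thesis unfolding fibre_def by blast
qed

lemma quotient_carrier: "carrierv quotient = fibre ` C"
proof -
  have "carrierv quotient = quotient_map cover cover_kernel ` {f. \<exists>z. represents f z}"
    by (simp add: quotient_lattice_def cover_simps)
  also have "\<dots> = fibre ` C"
  proof (intro equalityI subsetI; elim imageE)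
    fix K f assume "K = quotient_map cover cover_kernel f" "f \<in> {f. \<exists>z. represents f z}"
    then obtain z where "represents f z" "K = fibre z" using quotient_map_eq_fibre by blast
    then show "K \<in> fibre ` C" using represents_closed by blast
  next
    fix K z assume z: "z \<in> C" "K = fibre z"
    obtain f where f: "represents f z" using represents_surj[OF z(1)] by blast
    then show "K \<in> quotient_map cover cover_kernel ` {f. \<exists>z. represents f z}"
      using quotient_map_eq_fibre[OF f] z(2) by blast
  qed
  finally show ?thesis .
qed

lemma quotient_add:
  assumes "z \<in> C" "y \<in> C"
  shows "addv quotient (fibre z) (fibre y) = fibre (z [+] y)"
proof -
  have "\<exists>f g. h = (\<lambda>x. f x + g x) \<and> represents f z \<and> represents g y" if h: "represents h (z [+] y)" for h
  proof -
    obtain g where g: "represents g y" using represents_surj assms(2) by blast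
    have "represents (\<lambda>x. h x - g x) z"
      using represents_minus[OF h g] add_minus_cancel[OF assms] by simp
    then show ?thesis using g by (intro exI[of _ "\<lambda>x. h x - g x"] exI[of _ g]) auto
  qed
  then show ?thesis
    using represents_add by (fastforce simp: quotient_lattice_def cover_simps fibre_def)
qed

lemma quotient_scale:
  assumes "z \<in> C"
  shows "scalev quotient r (fibre z) = fibre (r [*] z)"
proof -
  have "\<exists>f j. h = (\<lambda>x. r * f x + j x) \<and> represents f z \<and> represents j [0]"
    if h: "represents h (r [*] z)" for h
  proof -
    obtain f where f: "represents f z" using represents_surj assms by blast
    have "represents (\<lambda>x. h x - r * f x) [0]"
      using represents_minus[OF h represents_scale[OF f, of r]] minus_self[OF scale_closed[OF assms]] by simp
    then show ?thesis using f by (intro exI[of _ f] exI[of _ "\<lambda>x. h x - r * f x"]) auto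
  qed
  moreover have "represents (\<lambda>x. r * f x + j x) (r [*] z)"
    if "represents f z" "represents j [0]" for f j
    using represents_add[OF represents_scale[OF that(1)] that(2)] add_zero[OF scale_closed[OF assms]]
    by simp
  ultimately show ?thesis
    by (fastforce simp: quotient_lattice_def cover_simps fibre_def)
qed

lemma quotient_le_iff:
  assumes "z \<in> C" "y \<in> C"
  shows "lev quotient (fibre z) (fibre y) \<longleftrightarrow> z [\<le>] y"
proof
  assume "lev quotient (fibre z) (fibre y)"
  then obtain f g where "represents f z" "represents g y" "\<And>x. f x \<le> g x"
    unfolding quotient_lattice_def cover_simps fibre_def by auto
  then show "z [\<le>] y" by (rule represents_mono)
next
  assume le: "z [\<le>] y"
  obtain f g where f: "represents f z" and g: "represents g y"
    using represents_surj assms by blast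
  have "represents (\<lambda>x. min (f x) (g x)) z"
    using represents_min[OF f g] inf_absorb[OF assms le] by simp
  then show "lev quotient (fibre z) (fibre y)"
    using g unfolding quotient_lattice_def cover_simps fibre_def by fastforce
qed

lemma quotient_norm:
  assumes "z \<in> C"
  shows "normv quotient (fibre z) = normv X z"
proof -
  obtain f where f: "represents f z" "near (normv X z) f (\<lambda>x. 0)" using represents_surj assms by blast
  have "Inf (cover_norm ` fibre z) = normv X z"
  proof (rule order_antisym)
    have "bdd_below (cover_norm ` fibre z)"
      unfolding fibre_def using cover_norm_nonneg by (intro bdd_belowI2[of _ 0]) auto
    then have "Inf (cover_norm ` fibre z) \<le> cover_norm f"
      using f(1) unfolding fibre_def by (intro cINF_lower) auto
    then show "Inf (cover_norm ` fibre z) \<le> normv X z" using cover_norm_le[OF f(2)] by simp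
    show "normv X z \<le> Inf (cover_norm ` fibre z)"
      using f(1) norm_le_cover_norm unfolding fibre_def by (intro cINF_greatest) auto
  qed
  then show ?thesis by (simp add: quotient_lattice_def cover_simps)
qed

lemma quotient_supv:
  assumes "z \<in> C" "y \<in> C"
  shows "supv quotient (fibre z) (fibre y) = fibre (z [\<squnion>] y)"
proof -
  have eq: "is_supv quotient (fibre z) (fibre y) s \<longleftrightarrow> s = fibre (z [\<squnion>] y)" for s
  proof -
    have "is_supv quotient (fibre z) (fibre y) s \<longleftrightarrow> (\<exists>u\<in>C. s = fibre u \<and> is_supv X z y u)"
      unfolding is_supv_def quotient_carrier using assms quotient_le_iff by auto
    then show ?thesis
      using is_supv_supv[OF assms] supv_eqI sup_closed[OF assms] by blast
  qed
  show ?thesis unfolding supv_def[of quotient] eq by simp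
qed

lemma quotient_infv:
  assumes "z \<in> C" "y \<in> C"
  shows "infv quotient (fibre z) (fibre y) = fibre (z [\<sqinter>] y)"
proof -
  have eq: "is_infv quotient (fibre z) (fibre y) s \<longleftrightarrow> s = fibre (z [\<sqinter>] y)" for s
  proof -
    have "is_infv quotient (fibre z) (fibre y) s \<longleftrightarrow> (\<exists>u\<in>C. s = fibre u \<and> is_infv X z y u)"
      unfolding is_infv_def quotient_carrier using assms quotient_le_iff by auto
    moreover have "z [\<sqinter>] y \<in> C" using is_infv_infv[OF assms] unfolding is_infv_def by blast
    ultimately show ?thesis
      using is_infv_infv[OF assms] infv_eqI by blast
  qed
  show ?thesis unfolding infv_def[of quotient] eq by simp
qed

lemma lattice_hom_fibre: "lattice_hom X quotient fibre"
  unfolding lattice_hom_def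
  using quotient_carrier quotient_add quotient_scale quotient_supv quotient_infv quotient_norm
  by (auto intro!: exI[of _ 1])

lemma op_norm_fibre_le: "op_norm X quotient fibre \<le> 1"
  unfolding op_norm_def using zero_closed norm_zero quotient_norm
  by (intro cSup_least) auto

lemma norm_le_op_norm:
  assumes T: "lattice_hom X Y T" and Y: "banach_lattice Y" and z: "z \<in> C"
  shows "normv Y (T z) \<le> op_norm X Y T * normv X z"
proof (cases "normv X z = 0")
  case True
  obtain K where "\<And>x. x \<in> C \<Longrightarrow> normv Y (T x) \<le> K * normv X x"
    using T unfolding lattice_hom_def by blast
  from this[OF z] show ?thesis using True by simp
next
  case False
  define n where "n = normv X z"
  have n: "0 < n" using norm_nonneg[OF z] False unfolding n_def by simp
  obtain K where K: "\<And>x. x \<in> C \<Longrightarrow> normv Y (T x) \<le> K * normv X x"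
    using T unfolding lattice_hom_def by blast
  have "bdd_above {normv Y (T x) |x. x \<in> C \<and> normv X x \<le> 1}"
  proof (rule bdd_aboveI)
    fix t assume "t \<in> {normv Y (T x) |x. x \<in> C \<and> normv X x \<le> 1}"
    then obtain x where x: "x \<in> C" "normv X x \<le> 1" "t = normv Y (T x)" by blast
    have "K * normv X x \<le> \<bar>K\<bar> * normv X x" using norm_nonneg[OF x(1)] by (intro mult_right_mono) auto
    also have "\<dots> \<le> \<bar>K\<bar> * 1" using x(2) by (intro mult_left_mono) auto
    finally show "t \<le> \<bar>K\<bar>" using K[OF x(1)] x(3) by simp
  qed
  moreover have "(1/n) [*] z \<in> C" "normv X ((1/n) [*] z) \<le> 1"
    using scale_closed[OF z] norm_scale[OF z] n unfolding n_def by auto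
  ultimately have "normv Y (T ((1/n) [*] z)) \<le> op_norm X Y T"
    unfolding op_norm_def by (intro cSup_upper) auto
  moreover have "normv Y (T ((1/n) [*] z)) = (1/n) * normv Y (T z)"
    using T z n banach_lattice.norm_scale[OF Y, of "T z" "1/n"] unfolding lattice_hom_def by simp
  ultimately show ?thesis using n unfolding n_def by (simp add: field_simps)
qed

text \<open>Finitely many values of functions in \<open>D\<close> are dominated by one function of \<open>D\<close>, hence by its
  majorant; compactness turns this into a majorant for all of \<open>D\<close>.\<close>

lemma directed_bound_in_cover:
  assumes "D \<noteq> {}" and near: "\<And>f. f \<in> D \<Longrightarrow> near r f (\<lambda>x. 0)"
    and directed: "\<And>f g. \<lbrakk>f \<in> D; g \<in> D\<rbrakk> \<Longrightarrow> \<exists>h\<in>D. (\<forall>x. f x \<le> h x) \<and> (\<forall>x. g x \<le> h x)"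
  shows "\<exists>c\<in>l1_ball unit_ball r. \<forall>f\<in>D. \<forall>x. f x \<le> weighted_norm c x"
proof -
  have "\<exists>c\<in>l1_ball unit_ball r. \<forall>(x, t)\<in>{(x, f x) |f x. f \<in> D}. t \<le> weighted_norm c x"
  proof (rule weighted_norm_compactness)
    fix E assume E: "finite E" "E \<subseteq> {(x, f x) |f x. f \<in> D}"
    have "\<exists>h\<in>D. \<forall>(x, t)\<in>E. t \<le> h x"
      using E
    proof (induction E)
      case empty
      then show ?case using assms(1) by auto
    next
      case (insert k E)
      then obtain h where h: "h \<in> D" "\<forall>(x, t)\<in>E. t \<le> h x" by auto
      obtain f y where f: "f \<in> D" "k = (y, f y)" using insert.prems by auto
      obtain g where g: "g \<in> D" "\<And>x. f x \<le> g x" "\<And>x. h x \<le> g x"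
        using directed[OF f(1) h(1)] by blast
      have "\<forall>(x, t)\<in>insert k E. t \<le> g x"
      proof clarify
        fix x t assume "(x, t) \<in> insert k E"
        then have "(x, t) = (y, f y) \<or> t \<le> h x" using f(2) h(2) by blast
        then show "t \<le> g x" using g(2)[of y] g(3)[of x] by auto
      qed
      then show ?case using g(1) by blast
    qed
    then obtain h where h: "h \<in> D" "\<forall>(x, t)\<in>E. t \<le> h x" by blast
    obtain c where c: "c \<in> l1_ball unit_ball r" "\<And>x. \<bar>h x\<bar> \<le> weighted_norm c x"
      using near[OF h(1)] unfolding near_def by auto
    have "\<forall>(x, t)\<in>E. t \<le> weighted_norm c x"
    proof clarify
      fix x t assume "(x, t) \<in> E"
      then have "t \<le> h x" using h(2) by blast
      then show "t \<le> weighted_norm c x" using c(2)[of x] by simp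
    qed
    then show "\<exists>c\<in>l1_ball unit_ball r. \<forall>(x, t)\<in>E. t \<le> weighted_norm c x" using c(1) by blast
  qed
  then show ?thesis by blast
qed

text \<open>If the supremum \<open>s\<close> of the norms is positive, a lift of norm less than \<open>l\<close> maps the directed set to
  functions of norm below \<open>l * s\<close>. A common majorant of this total weight represents the upper bound.\<close>

lemma strong_nakano_if_lift:
  assumes lift: "\<And>\<epsilon>. 0 < \<epsilon> \<Longrightarrow> \<exists>T. lattice_hom X cover T \<and> (\<forall>z\<in>C. represents (T z) z) \<and>
      op_norm X cover T \<le> 1 + \<epsilon>"
  shows "strong_nakano_1_plus X"
  unfolding strong_nakano_1_plus_def
proof (intro allI impI, elim conjE)
  fix A and l :: real
  assume A: "A \<subseteq> posv X" "A \<noteq> {}" and bdd: "bdd_above (normv X ` A)"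
    and dir: "\<forall>a\<in>A. \<forall>b\<in>A. \<exists>c\<in>A. a [\<le>] c \<and> b [\<le>] c" and l: "1 < l"
  define s where "s = Sup (normv X ` A)"
  have AC: "a \<in> C" if "a \<in> A" for a using that A(1) unfolding posv_def by auto
  have s: "normv X a \<le> s" if "a \<in> A" for a unfolding s_def using bdd that by (intro cSUP_upper)
  show "\<exists>b\<in>posv X. (\<forall>a\<in>A. a [\<le>] b) \<and> normv X b \<le> l * Sup (normv X ` A)"
  proof (cases "0 < s")
    case False
    have zero: "a = [0]" if "a \<in> A" for a
      using s[OF that] False norm_nonneg[OF AC[OF that]] norm_eq_zero[OF AC[OF that]] by linarith
    then have "A = {[0]}" using A(2) by blast
    then have "s = 0" unfolding s_def using norm_zero by simp
    then show ?thesis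
      using zero zero_closed le_refl[OF zero_closed] norm_zero unfolding s_def[symmetric] posv_def
      by (intro bexI[of _ "[0]"]) auto
  next
    case True
    obtain T where T: "lattice_hom X cover T" "\<And>z. z \<in> C \<Longrightarrow> represents (T z) z"
      "op_norm X cover T \<le> 1 + (l - 1) / 2"
      using lift[of "(l - 1) / 2"] l by auto
    have near: "near (l * s) (T a) (\<lambda>x. 0)" if a: "a \<in> A" for a
    proof (rule near_if_cover_norm_less[OF T(2)[OF AC[OF a]]])
      have "cover_norm (T a) \<le> op_norm X cover T * normv X a"
        using norm_le_op_norm[OF T(1) banach_lattice_cover AC[OF a]] unfolding cover_simps .
      also have "\<dots> \<le> (1 + (l - 1) / 2) * s"
        using T(3) s[OF a] norm_nonneg[OF AC[OF a]] l by (intro mult_mono) auto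
      also have "\<dots> < l * s"
        using l True by (intro mult_strict_right_mono) (simp_all add: field_simps)
      finally show "cover_norm (T a) < l * s" .
    qed
    have mono: "T a x \<le> T b x" if "a \<in> C" "b \<in> C" "a [\<le>] b" for a b x
    proof -
      have "T b = supv cover (T a) (T b)"
        using T(1) that sup_absorb[OF that] unfolding lattice_hom_def by metis
      also have "\<dots> = (\<lambda>x. max (T a x) (T b x))"
        using T(2) that by (intro supv_cover) (auto simp: cover_simps)
      finally show ?thesis by (metis max.cobounded1)
    qed
    have "\<exists>c\<in>l1_ball unit_ball (l * s). \<forall>f\<in>T ` A. \<forall>x. f x \<le> weighted_norm c x"
    proof (rule directed_bound_in_cover)
      show "\<exists>h\<in>T ` A. (\<forall>x. f x \<le> h x) \<and> (\<forall>x. g x \<le> h x)" if fg: "f \<in> T ` A" "g \<in> T ` A" for f g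
      proof -
        obtain a b where ab: "a \<in> A" "b \<in> A" "f = T a" "g = T b" using fg by blast
        obtain c where "c \<in> A" "a [\<le>] c" "b [\<le>] c" using dir ab by blast
        then show ?thesis using mono AC ab by (intro bexI[of _ "T c"]) auto
      qed
    qed (use A(2) near in auto)
    then obtain c where c: "c \<in> l1_ball unit_ball (l * s)" "\<And>a x. a \<in> A \<Longrightarrow> T a x \<le> weighted_norm c x"
      by blast
    obtain b where b: "represents (weighted_norm c) b" using represents_weighted_norm[OF c(1)] by blast
    have pos: "0 \<le> weighted_norm c x" for x using weighted_norm_nonneg l1_ball_nonneg[OF c(1)] by blast
    have "b \<in> posv X"
      using represents_closed[OF b] represents_mono[OF represents_zero b pos] unfolding posv_def by blast
    moreover have "a [\<le>] b" if "a \<in> A" for a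
      using represents_mono[OF T(2)[OF AC[OF that]] b c(2)[OF that]] .
    moreover have "near (l * s) (weighted_norm c) (\<lambda>x. 0)"
      unfolding near_def using c(1) pos by (intro bexI[of _ c]) auto
    then have "normv X b \<le> l * s" by (rule represents_norm_le[OF b])
    ultimately show ?thesis unfolding s_def by blast
  qed
qed

end

theorem corollary2p12:
  fixes Z :: "'a normed_lattice"
  assumes "banach_lattice Z"
    and "projective_lattice Z"
  shows "strong_nakano_1_plus Z"
proof -
  interpret banach_lattice Z by fact
  show ?thesis
  proof (rule strong_nakano_if_lift)
    fix \<epsilon> :: real assume \<epsilon>: "0 < \<epsilon>"
    then obtain T where T: "lattice_hom Z cover T"
      "\<forall>z\<in>carrierv Z. fibre z = quotient_map cover cover_kernel (T z)"
      "op_norm Z cover T \<le> (1 + \<epsilon>) * op_norm Z quotient fibre"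
      using assms(2) banach_lattice_cover closed_ideal_kernel lattice_hom_fibre
      unfolding projective_lattice_def by blast
    have "represents (T z) z" if z: "z \<in> carrierv Z" for z
    proof -
      obtain y where y: "represents (T z) y"
        using T(1) z unfolding lattice_hom_def cover_simps by blast
      then have "fibre z = fibre y" using quotient_map_eq_fibre T(2) z by metis
      then show ?thesis using y unfolding fibre_def by blast
    qed
    moreover have "(1 + \<epsilon>) * op_norm Z quotient fibre \<le> (1 + \<epsilon>) * 1"
      using \<epsilon> by (intro mult_left_mono op_norm_fibre_le) simp
    from order_trans[OF T(3) this] have "op_norm Z cover T \<le> 1 + \<epsilon>" by simp
    ultimately show "\<exists>T. lattice_hom Z cover T \<and> (\<forall>z\<in>carrierv Z. represents (T z) z) \<and>
        op_norm Z cover T \<le> 1 + \<epsilon>" using T(1) by blast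
  qed
qed

end
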